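(* Let $n\ge1$, $\varepsilon\neq0$, let $\Omega\subseteq\mathbb{R}^{2n}$ be a bounded domain and $H\in C^1(\Omega)$. Let $u\in C^3(\Omega)$ be a solution in $\Omega$ of $$\operatorname{div}\left(\frac{Du+X}{\sqrt{\varepsilon^2+|Du+X|^2}}\right)=H,$$ and let $\tilde\Omega\Subset\Omega$ be a domain. Then for every domain $\hat\Omega\Subset\tilde\Omega$ there exists a constant $C>0$ depending only on $n$, $\varepsilon$, $d(\partial\hat\Omega,\partial\tilde\Omega)$, $\|u\|_{L^\infty(\tilde\Omega)}$, $\|H\|_{C^1(\tilde\Omega)}$ and $\|X\|_{L^\infty(\tilde\Omega)}$ such that $$\|Du\|_{L^\infty(\hat\Omega)}\le C,$$ where $d(\partial\hat\Omega,\partial\tilde\Omega)$ is the Euclidean distance between $\partial\hat\Omega$ and $\partial\tilde\Omega$.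
   Context: Points of $\mathbb{R}^{2n}$ are written $z=(x,y)$ with $x,y\in\mathbb{R}^n$, and $X:\mathbb{R}^{2n}\to\mathbb{R}^{2n}$ is $X(x,y)=(-y,x)$. $D$ is the Euclidean gradient, $|\cdot|$ the Euclidean norm, $\operatorname{div}$ the Euclidean divergence. *)

theory Defs
  imports "HOL-Analysis.Analysis"
begin

definition grad :: "('a::euclidean_space \<Rightarrow> real) \<Rightarrow> 'a \<Rightarrow> 'a" where
  "grad f z = (\<Sum>b\<in>Basis. frechet_derivative f (at z) b *\<^sub>R b)"

definition divergence :: "('a::euclidean_space \<Rightarrow> 'a) \<Rightarrow> 'a \<Rightarrow> real" where
  "divergence F z = (\<Sum>b\<in>Basis. frechet_derivative F (at z) b \<bullet> b)"

definition Xf :: "(real^'n) \<times> (real^'n) \<Rightarrow> (real^'n) \<times> (real^'n)" where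
  "Xf z = (- snd z, fst z)"

fun Ck :: "nat \<Rightarrow> 'a::euclidean_space set \<Rightarrow> ('a \<Rightarrow> 'b::real_normed_vector) \<Rightarrow> bool" where
  "Ck 0 S f = continuous_on S f"
| "Ck (Suc k) S f = (f differentiable_on S \<and>
      (\<forall>b\<in>Basis. Ck k S (\<lambda>z. frechet_derivative f (at z) b)))"

definition is_domain :: "'a::euclidean_space set \<Rightarrow> bool" where
  "is_domain S \<longleftrightarrow> open S \<and> connected S \<and> S \<noteq> {}"

definition compactly_contained :: "'a::euclidean_space set \<Rightarrow> 'a set \<Rightarrow> bool" where
  "compactly_contained A B \<longleftrightarrow> compact (closure A) \<and> closure A \<subseteq> B"

text \<open>Sup norm on a set (L-infinity norm for continuous functions on open sets).\<close>
definition supnorm :: "'a set \<Rightarrow> ('a \<Rightarrow> 'b::real_normed_vector) \<Rightarrow> real" where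
  "supnorm S f = (SUP z\<in>S. norm (f z))"

definition C1norm :: "'a::euclidean_space set \<Rightarrow> ('a \<Rightarrow> real) \<Rightarrow> real" where
  "C1norm S f = supnorm S f + supnorm S (grad f)"

end

theory Submission
  imports Defs
begin

text \<open>
  The proof is Korevaar's maximum principle argument. Put \<open>p = Du + X\<close>, \<open>W = sqrt (\<epsilon>\<^sup>2 + |p|\<^sup>2)\<close>, and let
  \<open>\<eta> = exp (K \<phi>) - 1\<close> with \<open>\<phi> = (u - u z0) / c + 1 - 2 |z - z0|\<^sup>2 / R\<^sup>2\<close>, so that \<open>\<phi> < 0\<close> on the sphere of
  radius \<open>R\<close> about \<open>z0\<close>. Since \<open>DX\<close> is skew, the equation reads \<open>tr (A D\<^sup>2u) = H W\<close> with
  \<open>A = I - p p\<^sup>T / W\<^sup>2\<close>. Differentiating it in the direction \<open>p\<close> bounds \<open>tr (A D\<^sup>2W)\<close> from below; the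
  commutator terms produced by \<open>X\<close> are linear in the mixed entries of \<open>Dp\<close> and are absorbed by the
  squared shape operator at the cost of a multiple of \<open>1 / \<epsilon>\<^sup>2\<close>. At an interior maximum of \<open>W \<eta>\<close>
  this yields \<open>K (tr (A D\<^sup>2\<phi>) + K \<langle>A D\<phi>, D\<phi>\<rangle> - H \<langle>D\<phi>, p\<rangle> / W) \<le> |DH| + 17 / \<epsilon>\<^sup>2\<close>. If \<open>|p|\<close> is large
  there, then \<open>\<langle>A D\<phi>, D\<phi>\<rangle> \<ge> \<epsilon>\<^sup>2 / (8 c\<^sup>2)\<close> while the other terms stay bounded, which is impossible
  for the chosen \<open>K\<close>. Hence \<open>W\<close> is bounded at the maximum, and so at \<open>z0\<close>.
\<close>

section \<open>Second derivatives and local maxima\<close>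

text \<open>The mean value theorem in the direction \<open>v\<close> turns the second difference
  into a difference of two values of \<open>\<lambda>x. f' x v\<close>; expanding both to first
  order at \<open>z\<close> leaves \<open>t\<^sup>2 * D w\<close> and a small error.\<close>

lemma second_difference_tendsto:
  fixes f :: "'a::real_normed_vector \<Rightarrow> real"
  assumes S: "open S" "z \<in> S"
    and f: "\<And>x. x \<in> S \<Longrightarrow> (f has_derivative f' x) (at x)"
    and fv: "((\<lambda>x. f' x v) has_derivative D) (at z)"
  shows "((\<lambda>t. (f (z + t *\<^sub>R v + t *\<^sub>R w) - f (z + t *\<^sub>R v) - f (z + t *\<^sub>R w) + f z) / t\<^sup>2)
           \<longlongrightarrow> D w) (at_right 0)"
proof (rule tendstoI)
  fix e :: real assume "e > 0"
  \<comment> \<open>The errors at the two points add up to at most \<open>e' * t * (N - 1)\<close>,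
    so \<open>e' = e / (2 * N)\<close> stays strictly below \<open>e\<close>. The summand 1 keeps
    \<open>N\<close> positive when both vectors vanish.\<close>
  define N where "N = 2 * norm v + norm w + 1"
  have N: "N > 0" unfolding N_def by (smt (verit) norm_ge_zero)
  define e' where "e' = e / (2 * N)"
  have e': "e' > 0" using \<open>e > 0\<close> N by (simp add: e'_def)
  have D: "linear D" using fv has_derivative_linear by blast
  obtain d1 where d1: "d1 > 0"
    and app: "\<And>y. norm (y - z) < d1 \<Longrightarrow> norm (f' y v - f' z v - D (y - z)) \<le> e' * norm (y - z)"
    using fv e' unfolding has_derivative_at_alt by blast
  obtain d2 where d2: "d2 > 0" "ball z d2 \<subseteq> S"
    using S openE by blast
  define d where "d = min d1 d2 / N"
  have d: "d > 0" using d1 d2 N by (simp add: d_def)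
  have small: "norm (s *\<^sub>R v + r *\<^sub>R w) < min d1 d2" "norm (s *\<^sub>R v + r *\<^sub>R w) \<le> t * (norm v + norm w)"
    if "0 \<le> s" "s \<le> t" "0 \<le> r" "r \<le> t" "t < d" for s r t
  proof -
    have "norm (s *\<^sub>R v + r *\<^sub>R w) \<le> s * norm v + r * norm w"
      using norm_triangle_ineq[of "s *\<^sub>R v" "r *\<^sub>R w"] that by simp
    also have "\<dots> \<le> t * norm v + t * norm w"
      using that by (intro add_mono mult_right_mono) auto
    finally show le: "norm (s *\<^sub>R v + r *\<^sub>R w) \<le> t * (norm v + norm w)"
      by (simp add: algebra_simps)
    also have "\<dots> \<le> t * N"
      using that by (intro mult_left_mono) (auto simp: N_def)
    also have "\<dots> < d * N"
      using that N by simp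
    also have "\<dots> = min d1 d2" using N by (simp add: d_def)
    finally show "norm (s *\<^sub>R v + r *\<^sub>R w) < min d1 d2" .
  qed
  have "dist ((f (z + t *\<^sub>R v + t *\<^sub>R w) - f (z + t *\<^sub>R v) - f (z + t *\<^sub>R w) + f z) / t\<^sup>2) (D w) < e"
    if t: "0 < t" "t < d" for t
  proof -
    define \<Phi> where "\<Phi> s = f (z + s *\<^sub>R v + t *\<^sub>R w) - f (z + s *\<^sub>R v)" for s
    have inS: "z + s *\<^sub>R v + t *\<^sub>R w \<in> S" "z + s *\<^sub>R v \<in> S" if "0 \<le> s" "s \<le> t" for s
    proof -
      have "norm (s *\<^sub>R v + t *\<^sub>R w) < d2" "norm (s *\<^sub>R v + 0 *\<^sub>R w) < d2"
        using small(1)[of s t t] small(1)[of s t 0] that t by auto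
      then show "z + s *\<^sub>R v + t *\<^sub>R w \<in> S" "z + s *\<^sub>R v \<in> S"
        using d2(2) by (auto simp: subset_iff dist_norm norm_minus_commute add.assoc)
    qed
    have der: "(\<Phi> has_derivative (\<lambda>h. h * (f' (z + s *\<^sub>R v + t *\<^sub>R w) v - f' (z + s *\<^sub>R v) v))) (at s within {0..t})"
      if "0 \<le> s" "s \<le> t" for s
    proof -
      have 1: "((\<lambda>s. z + s *\<^sub>R v + t *\<^sub>R w) has_derivative (\<lambda>h. h *\<^sub>R v)) (at s within {0..t})"
        by (auto intro!: derivative_eq_intros)
      have 2: "((\<lambda>s. z + s *\<^sub>R v) has_derivative (\<lambda>h. h *\<^sub>R v)) (at s within {0..t})"
        by (auto intro!: derivative_eq_intros)
      have "(\<Phi> has_derivative (\<lambda>h. f' (z + s *\<^sub>R v + t *\<^sub>R w) (h *\<^sub>R v) - f' (z + s *\<^sub>R v) (h *\<^sub>R v))) (at s within {0..t})"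
        unfolding \<Phi>_def
        using has_derivative_compose[OF 1 f[OF inS(1)[OF that]]] has_derivative_compose[OF 2 f[OF inS(2)[OF that]]]
        by (rule has_derivative_diff)
      moreover have "f' x (h *\<^sub>R v) = h * f' x v" if "x \<in> S" for x h
        using linear_scale[OF has_derivative_linear[OF f[OF that]], of h v] by simp
      ultimately show ?thesis
        using inS[OF that] by (simp add: right_diff_distrib)
    qed
    obtain s where s: "0 < s" "s < t"
      and mvt: "\<Phi> t - \<Phi> 0 = (t - 0) * (f' (z + s *\<^sub>R v + t *\<^sub>R w) v - f' (z + s *\<^sub>R v) v)"
      using mvt_simple[OF t(1), of \<Phi> "\<lambda>s h. h * (f' (z + s *\<^sub>R v + t *\<^sub>R w) v - f' (z + s *\<^sub>R v) v)"] der
      by auto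
    define E1 where "E1 = f' (z + s *\<^sub>R v + t *\<^sub>R w) v - f' z v - D (s *\<^sub>R v + t *\<^sub>R w)"
    define E2 where "E2 = f' (z + s *\<^sub>R v) v - f' z v - D (s *\<^sub>R v)"
    have E1: "\<bar>E1\<bar> \<le> e' * (t * (norm v + norm w))"
    proof -
      have "\<bar>E1\<bar> \<le> e' * norm (s *\<^sub>R v + t *\<^sub>R w)"
        using app[of "z + s *\<^sub>R v + t *\<^sub>R w"] small(1)[of s t t] s t by (simp add: E1_def add.assoc)
      then show ?thesis
        using small(2)[of s t t] s t e' by (smt (verit) mult_left_mono)
    qed
    have E2: "\<bar>E2\<bar> \<le> e' * (t * norm v)"
    proof -
      have "\<bar>E2\<bar> \<le> e' * norm (s *\<^sub>R v)"
        using app[of "z + s *\<^sub>R v"] small(1)[of s t 0] s t by (simp add: E2_def)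
      also have "\<dots> \<le> e' * (t * norm v)"
        using s e' by (intro mult_left_mono) (auto intro: mult_right_mono)
      finally show ?thesis .
    qed
    \<comment> \<open>The intermediate \<open>s\<close> is unknown, but
      \<open>D (s *\<^sub>R v)\<close> occurs in both expansions and cancels.\<close>
    have "\<Phi> t - \<Phi> 0 = t * (t * D w + E1 - E2)"
      unfolding mvt E1_def E2_def by (simp add: linear_add[OF D] linear_scale[OF D])
    then have "f (z + t *\<^sub>R v + t *\<^sub>R w) - f (z + t *\<^sub>R v) - f (z + t *\<^sub>R w) + f z = t * (t * D w + E1 - E2)"
      by (simp add: \<Phi>_def)
    then have "(f (z + t *\<^sub>R v + t *\<^sub>R w) - f (z + t *\<^sub>R v) - f (z + t *\<^sub>R w) + f z) / t\<^sup>2 - D w = (E1 - E2) / t"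
      using t by (simp only:) (simp add: field_simps power2_eq_square)
    moreover have "\<bar>(E1 - E2) / t\<bar> < e"
    proof -
      have "\<bar>E1 - E2\<bar> \<le> e' * t * N"
      proof -
        have "e' * (t * (norm v + norm w)) + e' * (t * norm v) = e' * t * (N - 1)"
          by (simp add: N_def algebra_simps)
        also have "\<dots> \<le> e' * t * N" using e' t by simp
        finally show ?thesis using E1 E2 by linarith
      qed
      then have "\<bar>(E1 - E2) / t\<bar> \<le> e' * N" using t by (simp add: field_simps)
      also have "\<dots> < e" using N \<open>e > 0\<close> by (simp add: e'_def)
      finally show ?thesis .
    qed
    ultimately show ?thesis by (simp add: dist_real_def)
  qed
  then show "\<forall>\<^sub>F t in at_right 0. dist ((f (z + t *\<^sub>R v + t *\<^sub>R w) - f (z + t *\<^sub>R v) - f (z + t *\<^sub>R w) + f z) / t\<^sup>2) (D w) < e"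
    using d by (auto simp: eventually_at_right_field)
qed

text \<open>The second difference is symmetric in \<open>v\<close> and \<open>w\<close>, so one and
  the same quotient tends to \<open>D w\<close> and to \<open>E v\<close>.\<close>

lemma second_derivative_symmetric:
  fixes f :: "'a::real_normed_vector \<Rightarrow> real"
  assumes "open S" "z \<in> S"
    and "\<And>x. x \<in> S \<Longrightarrow> (f has_derivative f' x) (at x)"
    and "((\<lambda>x. f' x v) has_derivative D) (at z)"
    and "((\<lambda>x. f' x w) has_derivative E) (at z)"
  shows "D w = E v"
proof -
  have "((\<lambda>t. (f (z + t *\<^sub>R v + t *\<^sub>R w) - f (z + t *\<^sub>R v) - f (z + t *\<^sub>R w) + f z) / t\<^sup>2)
           \<longlongrightarrow> E v) (at_right 0)"
    using second_difference_tendsto[OF assms(1,2,3,5), of v] by (simp add: algebra_simps)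
  with second_difference_tendsto[OF assms(1,2,3,4), of w] show ?thesis
    using tendsto_unique trivial_limit_at_right_real by blast
qed

section \<open>Conditions at a maximum on a line\<close>

lemma second_derivative_nonpos_at_local_max:
  fixes h :: "real \<Rightarrow> real"
  assumes r: "r > 0"
    and h: "\<And>t. \<bar>t\<bar> < r \<Longrightarrow> (h has_real_derivative h1 t) (at t)"
    and h1: "(h1 has_real_derivative h2) (at 0)"
    and max: "\<And>t. \<bar>t\<bar> < r \<Longrightarrow> h t \<le> h 0"
  shows "h1 0 = 0" "h2 \<le> 0"
proof -
  show 0: "h1 0 = 0"
    using DERIV_local_max[OF h[of 0] r] max r by simp
  show "h2 \<le> 0"
  proof (rule ccontr)
    assume "\<not> h2 \<le> 0"
    then obtain d where d: "d > 0" "\<And>t. 0 < t \<Longrightarrow> t < d \<Longrightarrow> h1 t > 0"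
      using DERIV_pos_inc_right[OF h1] 0 by auto
    define t where "t = min d r / 2"
    have t: "0 < t" "t < d" "t < r" using d r by (auto simp: t_def)
    have "h 0 < h t"
    proof (rule DERIV_pos_imp_increasing_open[OF t(1)])
      fix x assume "0 < x" "x < t"
      then show "\<exists>y. (h has_real_derivative y) (at x) \<and> 0 < y"
        using h[of x] d(2)[of x] t by auto
    next
      show "continuous_on {0..t} h"
        using h t by (intro DERIV_atLeastAtMost_imp_continuous_on) (metis abs_of_nonneg le_less_trans)
    qed
    then show False using max[of t] t by simp
  qed
qed

text \<open>Meant for \<open>w = W\<^sup>2\<close>, which is quadratic in \<open>p\<close> and
  avoids the square root. The first order condition gives
  \<open>w1 0 / w 0 = - 2 * \<eta>1 0 / \<eta> 0\<close>; with it the mixed term and the square of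
  \<open>\<eta>1 0\<close> merge into the coefficient -3/4.\<close>

lemma weighted_square_local_max:
  fixes w \<eta> :: "real \<Rightarrow> real"
  assumes r: "r > 0"
    and w: "\<And>t. \<bar>t\<bar> < r \<Longrightarrow> (w has_real_derivative w1 t) (at t)" "(w1 has_real_derivative w2) (at 0)"
    and \<eta>: "\<And>t. \<bar>t\<bar> < r \<Longrightarrow> (\<eta> has_real_derivative \<eta>1 t) (at t)" "(\<eta>1 has_real_derivative \<eta>2) (at 0)"
    and max: "\<And>t. \<bar>t\<bar> < r \<Longrightarrow> w t * (\<eta> t)\<^sup>2 \<le> w 0 * (\<eta> 0)\<^sup>2"
    and pos: "w 0 > 0" "\<eta> 0 > 0"
  shows "w1 0 * \<eta> 0 = - 2 * w 0 * \<eta>1 0"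
    and "w2 / (2 * w 0) - 3 / 4 * (w1 0 / w 0)\<^sup>2 + \<eta>2 / \<eta> 0 \<le> 0"
proof -
  define h1 where "h1 t = w1 t * (\<eta> t)\<^sup>2 + w t * (2 * \<eta> t * \<eta>1 t)" for t
  define h2 where "h2 = w2 * (\<eta> 0)\<^sup>2 + w1 0 * (2 * \<eta> 0 * \<eta>1 0)
     + (w1 0 * (2 * \<eta> 0 * \<eta>1 0) + w 0 * (2 * \<eta>1 0 * \<eta>1 0 + 2 * \<eta> 0 * \<eta>2))"
  have h: "((\<lambda>t. w t * (\<eta> t)\<^sup>2) has_real_derivative h1 t) (at t)" if "\<bar>t\<bar> < r" for t
    unfolding h1_def by (rule derivative_eq_intros w \<eta> refl that | simp)+
  have h1: "(h1 has_real_derivative h2) (at 0)"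
    unfolding h1_def h2_def using r
    by (auto intro!: derivative_eq_intros w \<eta> w(1)[of 0] \<eta>(1)[of 0] simp: algebra_simps)
  have 0: "h1 0 = 0" and le: "h2 \<le> 0"
    using second_derivative_nonpos_at_local_max[OF r h h1 max] by auto
  from 0 have "\<eta> 0 * (w1 0 * \<eta> 0 + 2 * w 0 * \<eta>1 0) = 0"
    by (simp add: h1_def power2_eq_square algebra_simps)
  then show eq: "w1 0 * \<eta> 0 = - 2 * w 0 * \<eta>1 0" using pos by auto
  define q where "q = \<eta>1 0 / \<eta> 0"
  have \<eta>1: "\<eta>1 0 = q * \<eta> 0" using pos by (simp add: q_def)
  have w1: "w1 0 = - 2 * w 0 * q" using eq pos by (simp add: q_def field_simps)
  have "h2 = 2 * w 0 * (\<eta> 0)\<^sup>2 * (w2 / (2 * w 0) - 3 / 4 * (w1 0 / w 0)\<^sup>2 + \<eta>2 / \<eta> 0)"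
    unfolding h2_def \<eta>1 w1 using pos by (simp add: field_simps power2_eq_square)
  then show "w2 / (2 * w 0) - 3 / 4 * (w1 0 / w 0)\<^sup>2 + \<eta>2 / \<eta> 0 \<le> 0"
    using le pos by (simp add: mult_le_0_iff)
qed

section \<open>The coefficient matrix of the equation\<close>

definition area_density :: "real \<Rightarrow> 'a::real_inner \<Rightarrow> real" where
  "area_density \<epsilon> p = sqrt (\<epsilon>\<^sup>2 + (norm p)\<^sup>2)"

text \<open>The positive square root of \<open>I - p p\<^sup>T / W\<^sup>2\<close>, so that traces against this matrix become sums
  over the frame \<open>shrink \<epsilon> p b\<close>.\<close>

definition shrink :: "real \<Rightarrow> 'a::real_inner \<Rightarrow> 'a \<Rightarrow> 'a" where
  "shrink \<epsilon> p x = x - ((p \<bullet> x) / (area_density \<epsilon> p * (area_density \<epsilon> p + \<epsilon>))) *\<^sub>R p"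

lemma area_density_square: "(area_density \<epsilon> p)\<^sup>2 = \<epsilon>\<^sup>2 + (norm p)\<^sup>2"
  by (simp add: area_density_def)

lemma area_density_bounds:
  assumes "\<epsilon> > 0"
  shows "area_density \<epsilon> p \<ge> \<epsilon>" "area_density \<epsilon> p \<ge> norm p" "area_density \<epsilon> p > 0"
    "area_density \<epsilon> p \<le> \<epsilon> + norm p"
proof -
  show 1: "area_density \<epsilon> p \<ge> \<epsilon>" "area_density \<epsilon> p \<ge> norm p"
    unfolding area_density_def by (auto intro: real_le_rsqrt)
  show "area_density \<epsilon> p > 0" using 1 assms by simp
  show "area_density \<epsilon> p \<le> \<epsilon> + norm p"
    using assms sqrt_sum_squares_le_sum[of \<epsilon> "norm p"] by (simp add: area_density_def)
qed

lemma has_derivative_area_density: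
  assumes "\<epsilon> \<noteq> 0" and p: "(p has_derivative P) (at z)"
  shows "((\<lambda>x. area_density \<epsilon> (p x)) has_derivative (\<lambda>v. (p z \<bullet> P v) / area_density \<epsilon> (p z))) (at z)"
proof -
  have d: "((\<lambda>x. \<epsilon>\<^sup>2 + p x \<bullet> p x) has_derivative (\<lambda>v. 2 * (p z \<bullet> P v))) (at z)"
    by (auto intro!: derivative_eq_intros p simp: inner_commute)
  have pos: "0 < \<epsilon>\<^sup>2 + p z \<bullet> p z" using assms(1) by (simp add: add_pos_nonneg)
  have "((\<lambda>x. sqrt (\<epsilon>\<^sup>2 + p x \<bullet> p x)) has_derivative
      (\<lambda>v. 2 * (p z \<bullet> P v) * (inverse (sqrt (\<epsilon>\<^sup>2 + p z \<bullet> p z)) / 2))) (at z)"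
    by (rule DERIV_compose_FDERIV[OF DERIV_real_sqrt d]) (rule pos)
  then show ?thesis
    by (simp add: area_density_def power2_norm_eq_inner field_simps)
qed

text \<open>Both rest on \<open>|p|\<^sup>2 = (W + \<epsilon>) * (W - \<epsilon>)\<close>. With
  \<open>k = 1 / (W * (W + \<epsilon>))\<close> the first says that \<open>I - k p p\<^sup>T\<close>
  squares to \<open>I - p p\<^sup>T / W\<^sup>2\<close>, the second that it multiplies
  \<open>p\<close> by \<open>\<epsilon> / W\<close>.\<close>

lemma shrink_coeff:
  fixes p :: "'a::real_inner"
  assumes "\<epsilon> > 0"
  defines "W \<equiv> area_density \<epsilon> p"
  shows "2 * (1 / (W * (W + \<epsilon>))) - (1 / (W * (W + \<epsilon>)))\<^sup>2 * (norm p)\<^sup>2 = 1 / W\<^sup>2"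
    "1 - (norm p)\<^sup>2 / (W * (W + \<epsilon>)) = \<epsilon> / W"
proof -
  have W: "W > 0" using area_density_bounds[OF assms(1)] by (simp add: W_def)
  have n: "(norm p)\<^sup>2 = (W + \<epsilon>) * (W - \<epsilon>)"
    using area_density_square[of \<epsilon> p] by (simp add: W_def algebra_simps power2_eq_square)
  have ne: "W + \<epsilon> \<noteq> 0" using W assms(1) by linarith
  show "2 * (1 / (W * (W + \<epsilon>))) - (1 / (W * (W + \<epsilon>)))\<^sup>2 * (norm p)\<^sup>2 = 1 / W\<^sup>2"
    unfolding n using W ne by (simp add: divide_simps power2_eq_square)
  show "1 - (norm p)\<^sup>2 / (W * (W + \<epsilon>)) = \<epsilon> / W"
    unfolding n using W ne by (simp add: divide_simps)
qed

section \<open>Traces and quadratic forms of the coefficient matrix\<close>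

lemma sum_Basis_inner_square:
  fixes p :: "'a::euclidean_space"
  shows "(\<Sum>b\<in>Basis. (p \<bullet> b)\<^sup>2) = (norm p)\<^sup>2"
  unfolding power2_norm_eq_inner euclidean_inner[of p p] by (simp add: power2_eq_square)

text \<open>This is the trace of \<open>q\<close> against \<open>A\<close>, computed in the frame
  given by its root. Expanding both slots and resumming over the basis yields \<open>q p p\<close>
  with coefficient \<open>2 * k - k\<^sup>2 * |p|\<^sup>2\<close>.\<close>

lemma sum_shrink_frame:
  fixes p :: "'a::euclidean_space" and q :: "'a \<Rightarrow> 'a \<Rightarrow> real"
  assumes "\<epsilon> > 0" and q: "bilinear q"
  shows "(\<Sum>b\<in>Basis. q (shrink \<epsilon> p b) (shrink \<epsilon> p b)) =
    (\<Sum>b\<in>Basis. q b b) - q p p / (area_density \<epsilon> p)\<^sup>2"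
proof -
  define k where "k = 1 / (area_density \<epsilon> p * (area_density \<epsilon> p + \<epsilon>))"
  have "q (shrink \<epsilon> p b) (shrink \<epsilon> p b) = q b b - k * ((p \<bullet> b) * q b p) - k * ((p \<bullet> b) * q p b)
          + k\<^sup>2 * q p p * (p \<bullet> b)\<^sup>2" for b
    unfolding shrink_def k_def
    by (simp add: bilinear_lsub[OF q] bilinear_rsub[OF q] bilinear_lmul[OF q] bilinear_rmul[OF q]
        power2_eq_square algebra_simps add_divide_distrib)
  then have "(\<Sum>b\<in>Basis. q (shrink \<epsilon> p b) (shrink \<epsilon> p b)) =
      (\<Sum>b\<in>Basis. q b b) - k * (\<Sum>b\<in>Basis. (p \<bullet> b) * q b p) - k * (\<Sum>b\<in>Basis. (p \<bullet> b) * q p b)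
          + k\<^sup>2 * q p p * (\<Sum>b\<in>Basis. (p \<bullet> b)\<^sup>2)"
    by (simp add: sum.distrib sum_subtractf sum_distrib_left)
  also have "(\<Sum>b\<in>Basis. (p \<bullet> b) * q b p) = q (\<Sum>b\<in>Basis. (p \<bullet> b) *\<^sub>R b) p"
    using q by (simp add: bilinear_def linear_sum[of "\<lambda>x. q x p"] linear_scale[of "\<lambda>x. q x p"])
  also have "(\<Sum>b\<in>Basis. (p \<bullet> b) * q p b) = q p (\<Sum>b\<in>Basis. (p \<bullet> b) *\<^sub>R b)"
    using q by (simp add: bilinear_def linear_sum[of "q p"] linear_scale[of "q p"])
  also have "(\<Sum>b\<in>Basis. (p \<bullet> b)\<^sup>2) = (norm p)\<^sup>2"
    by (rule sum_Basis_inner_square)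
  also have "(\<Sum>b\<in>Basis. q b b) - k * q (\<Sum>b\<in>Basis. (p \<bullet> b) *\<^sub>R b) p
      - k * q p (\<Sum>b\<in>Basis. (p \<bullet> b) *\<^sub>R b) + k\<^sup>2 * q p p * (norm p)\<^sup>2
      = (\<Sum>b\<in>Basis. q b b) - (2 * k - k\<^sup>2 * (norm p)\<^sup>2) * q p p"
    by (simp add: euclidean_representation algebra_simps)
  also have "2 * k - k\<^sup>2 * (norm p)\<^sup>2 = 1 / (area_density \<epsilon> p)\<^sup>2"
    unfolding k_def by (rule shrink_coeff(1)[OF assms(1)])
  finally show ?thesis by simp
qed

lemma sum_shrink_inner:
  fixes p a :: "'a::euclidean_space"
  assumes "\<epsilon> > 0"
  shows "(\<Sum>b\<in>Basis. (a \<bullet> shrink \<epsilon> p b)\<^sup>2) = (norm a)\<^sup>2 - (a \<bullet> p)\<^sup>2 / (area_density \<epsilon> p)\<^sup>2"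
proof -
  have "bilinear (\<lambda>x y. (a \<bullet> x) * (a \<bullet> y))"
    by (auto simp: bilinear_def intro!: linearI simp: algebra_simps inner_add_right)
  from sum_shrink_frame[OF assms this, of p] show ?thesis
    by (simp add: sum_Basis_inner_square flip: power2_eq_square)
qed

lemma norm_shrink_square:
  fixes p x :: "'a::real_inner"
  assumes "\<epsilon> > 0"
  shows "(norm (shrink \<epsilon> p x))\<^sup>2 = (norm x)\<^sup>2 - (p \<bullet> x)\<^sup>2 / (area_density \<epsilon> p)\<^sup>2"
proof -
  define k where "k = 1 / (area_density \<epsilon> p * (area_density \<epsilon> p + \<epsilon>))"
  have "(norm (shrink \<epsilon> p x))\<^sup>2 = (norm x)\<^sup>2 - (2 * k - k\<^sup>2 * (norm p)\<^sup>2) * (p \<bullet> x)\<^sup>2"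
    unfolding shrink_def power2_norm_eq_inner k_def
    by (simp add: inner_diff_left inner_diff_right inner_commute power2_eq_square algebra_simps
        add_divide_distrib)
  also have "2 * k - k\<^sup>2 * (norm p)\<^sup>2 = 1 / (area_density \<epsilon> p)\<^sup>2"
    unfolding k_def by (rule shrink_coeff(1)[OF assms])
  finally show ?thesis by simp
qed

lemma shrink_self:
  assumes "\<epsilon> > 0"
  shows "shrink \<epsilon> p p = (\<epsilon> / area_density \<epsilon> p) *\<^sub>R p"
  unfolding shrink_coeff(2)[OF assms, of p, symmetric]
  by (simp add: shrink_def power2_norm_eq_inner scaleR_left_diff_distrib)

lemma linear_shrink: "linear (shrink \<epsilon> p)"
  by (rule linearI) (simp_all add: shrink_def inner_add_right scaleR_left_distrib add_divide_distrib
      algebra_simps)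

text \<open>With \<open>B = shrink \<epsilon> p\<close>, the map \<open>B P B\<close> plays the role
  of the shape operator up to a factor \<open>W\<close>. As \<open>B\<close> fixes \<open>y\<close>
  under the inner product and \<open>B p = (\<epsilon> / W) p\<close>, the number
  \<open>P p \<bullet> y\<close> is \<open>W / \<epsilon>\<close> times an entry of
  \<open>B P B\<close>, which the Hilbert-Schmidt norm controls.\<close>

lemma mixed_second_fundamental_bound:
  fixes p y :: "'a::euclidean_space"
  assumes \<epsilon>: "\<epsilon> > 0" and P: "linear P" and y: "p \<bullet> y = 0"
  defines "W \<equiv> area_density \<epsilon> p"
  shows "(\<epsilon> * (P p \<bullet> y))\<^sup>2 \<le> (W * norm y * norm p)\<^sup>2 *
    (\<Sum>b\<in>Basis. (norm (shrink \<epsilon> p (P (shrink \<epsilon> p b))))\<^sup>2)"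
proof -
  define B where "B = shrink \<epsilon> p"
  define G where "G = (\<Sum>b\<in>Basis. (norm (B (P (B b))))\<^sup>2)"
  have W: "W > 0" using area_density_bounds[OF \<epsilon>] by (simp add: W_def)
  have lB: "linear B" unfolding B_def by (rule linear_shrink)
  have inB: "B x \<bullet> y = x \<bullet> y" for x
    using y by (simp add: B_def shrink_def inner_diff_left)
  have "B (P (B p)) = (\<Sum>b\<in>Basis. (p \<bullet> b) *\<^sub>R B (P (B b)))"
  proof -
    have l: "linear (\<lambda>x. B (P (B x)))"
      using linear_compose[OF linear_compose[OF lB P] lB] by (simp add: o_def)
    have "B (P (B (\<Sum>b\<in>Basis. (p \<bullet> b) *\<^sub>R b))) = (\<Sum>b\<in>Basis. (p \<bullet> b) *\<^sub>R B (P (B b)))"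
      by (simp add: linear_sum[OF l] linear_scale[OF l])
    then show ?thesis by (simp add: euclidean_representation)
  qed
  then have "norm (B (P (B p))) \<le> (\<Sum>b\<in>Basis. \<bar>p \<bullet> b\<bar> * norm (B (P (B b))))"
    by (simp add: sum_norm_le)
  then have "(norm (B (P (B p))))\<^sup>2 \<le> (\<Sum>b\<in>Basis. \<bar>p \<bullet> b\<bar> * norm (B (P (B b))))\<^sup>2"
    by (intro power_mono) auto
  also have "\<dots> \<le> (\<Sum>b\<in>Basis. \<bar>p \<bullet> b\<bar>\<^sup>2) * G"
    unfolding G_def by (rule Cauchy_Schwarz_ineq_sum)
  also have "(\<Sum>b\<in>Basis. \<bar>p \<bullet> b\<bar>\<^sup>2) = (norm p)\<^sup>2"
    by (simp add: sum_Basis_inner_square)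
  finally have 1: "(norm (B (P (B p))))\<^sup>2 \<le> (norm p)\<^sup>2 * G" .
  have "\<epsilon> * (P p \<bullet> y) = W * (B (P (B p)) \<bullet> y)"
    using W shrink_self[OF \<epsilon>, of p] by (simp add: inB) (simp add: B_def W_def linear_scale[OF P])
  then have "(\<epsilon> * (P p \<bullet> y))\<^sup>2 = W\<^sup>2 * (B (P (B p)) \<bullet> y)\<^sup>2"
    by (simp add: power_mult_distrib)
  also have "\<dots> \<le> W\<^sup>2 * ((norm (B (P (B p))))\<^sup>2 * (norm y)\<^sup>2)"
    by (intro mult_left_mono) (use Cauchy_Schwarz_ineq[of "B (P (B p))" y] in \<open>auto simp: power2_norm_eq_inner\<close>)
  also have "\<dots> \<le> W\<^sup>2 * (((norm p)\<^sup>2 * G) * (norm y)\<^sup>2)"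
    by (intro mult_left_mono mult_right_mono 1) auto
  finally show ?thesis
    by (simp add: G_def B_def power_mult_distrib mult_ac)
qed

text \<open>Splitting off the sum of squares \<open>G\<close> of \<open>B P B\<close> leaves only
  what the skew part produces, \<open>2 * (3 * s - 4 * |p|\<^sup>2) / W ^ 4\<close> with
  \<open>s = P p \<bullet> J p\<close>. The constant is 17 = 9 + 8: absorbing \<open>s\<close> into
  \<open>G\<close> costs 9, the term in \<open>|p|\<^sup>2\<close> costs 8.\<close>

lemma commutator_terms_bound:
  fixes p :: "'a::euclidean_space" and Q J :: "'a \<Rightarrow> 'a"
  assumes \<epsilon>: "\<epsilon> > 0" and Q: "linear Q" "\<And>x y. Q x \<bullet> y = x \<bullet> Q y"
    and J: "linear J" "\<And>x y. J x \<bullet> y = - (x \<bullet> J y)" "\<And>x. norm (J x) = norm x"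
  defines "W \<equiv> area_density \<epsilon> p" and "P \<equiv> \<lambda>x. Q x + J x" and "B \<equiv> shrink \<epsilon> p"
  shows "(\<Sum>b\<in>Basis. (norm (P (B b)))\<^sup>2 / W\<^sup>2 - 3 * (p \<bullet> P (B b))\<^sup>2 / W ^ 4)
     + 2 * (P p \<bullet> Q p) / W ^ 4 - 2 * (p \<bullet> Q p)\<^sup>2 / W ^ 6 \<ge> - 17 / \<epsilon>\<^sup>2"
proof -
  define G where "G = (\<Sum>b\<in>Basis. (norm (B (P (B b))))\<^sup>2)"
  \<comment> \<open>The transpose of \<open>P\<close> applied to \<open>p\<close>; the minus sign
    comes from skewness of \<open>J\<close>.\<close>
  define a where "a = Q p - J p"
  have W: "W > 0" "W \<ge> \<epsilon>" "W \<ge> norm p"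
    using area_density_bounds[OF \<epsilon>] by (auto simp: W_def)
  have pJ: "p \<bullet> J p = 0" using J(2)[of p p] by (simp add: inner_commute)
  have P: "linear P" unfolding P_def by (intro linear_compose_add Q J)
  have pP: "p \<bullet> P x = a \<bullet> x" for x
    using Q(2)[of p x] J(2)[of p x] by (simp add: P_def a_def inner_add_right inner_diff_left)
  have sa: "(\<Sum>b\<in>Basis. (p \<bullet> P (B b))\<^sup>2) = (norm a)\<^sup>2 - (p \<bullet> Q p)\<^sup>2 / W\<^sup>2"
    unfolding pP B_def sum_shrink_inner[OF \<epsilon>] W_def
    using pJ by (simp add: a_def inner_diff_right inner_commute[of _ p])
  have G: "(\<Sum>b\<in>Basis. (norm (P (B b)))\<^sup>2) = G + (\<Sum>b\<in>Basis. (p \<bullet> P (B b))\<^sup>2) / W\<^sup>2"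
    unfolding G_def B_def norm_shrink_square[OF \<epsilon>] W_def
    by (simp add: sum_subtractf sum_divide_distrib)
  define s where "s = P p \<bullet> J p"
  have "(\<epsilon> * s)\<^sup>2 \<le> (W * norm p * norm p)\<^sup>2 * G"
    using mixed_second_fundamental_bound[OF \<epsilon> P pJ] by (simp add: s_def J(3) W_def G_def B_def)
  also have "\<dots> \<le> (W * W * W)\<^sup>2 * G"
    using W by (intro mult_right_mono power_mono mult_mono) (auto simp: G_def intro: sum_nonneg)
  finally have s: "(\<epsilon> * s)\<^sup>2 \<le> W ^ 6 * G" by (simp add: power2_eq_square power_numeral_reduce mult_ac)
  have Pq: "P p \<bullet> Q p - (norm a)\<^sup>2 = 3 * s - 4 * (norm p)\<^sup>2"
  proof -
    have "P p \<bullet> Q p - (norm a)\<^sup>2 = 3 * (Q p \<bullet> J p) - (norm (J p))\<^sup>2"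
      by (simp add: P_def a_def power2_norm_eq_inner inner_add_left inner_add_right inner_diff_left
          inner_diff_right inner_commute)
    also have "Q p \<bullet> J p = s - (norm (J p))\<^sup>2"
      by (simp add: s_def P_def power2_norm_eq_inner inner_add_left)
    finally show ?thesis by (simp add: J(3))
  qed
  have "(\<Sum>b\<in>Basis. (norm (P (B b)))\<^sup>2 / W\<^sup>2 - 3 * (p \<bullet> P (B b))\<^sup>2 / W ^ 4)
     + 2 * (P p \<bullet> Q p) / W ^ 4 - 2 * (p \<bullet> Q p)\<^sup>2 / W ^ 6
    = (\<Sum>b\<in>Basis. (norm (P (B b)))\<^sup>2) / W\<^sup>2 - 3 * (\<Sum>b\<in>Basis. (p \<bullet> P (B b))\<^sup>2) / W ^ 4
     + 2 * (P p \<bullet> Q p) / W ^ 4 - 2 * (p \<bullet> Q p)\<^sup>2 / W ^ 6"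
    by (simp add: sum_subtractf sum_divide_distrib sum_distrib_left)
  \<comment> \<open>Extracting \<open>G\<close> changes the coefficient -3 into -2, and then
    \<open>sa\<close> cancels both terms with
    \<open>(p \<bullet> Q p)\<^sup>2 / W ^ 6\<close>.\<close>
  also have "\<dots> = G / W\<^sup>2 + 2 * (P p \<bullet> Q p - (norm a)\<^sup>2) / W ^ 4"
    unfolding G sa using W by (simp add: field_simps power_numeral_reduce)
  also have "\<dots> = G / W\<^sup>2 + 6 * s / W ^ 4 - 8 * (norm p)\<^sup>2 / W ^ 4"
    unfolding Pq by (simp add: diff_divide_distrib)
  also have "\<dots> \<ge> - 9 / \<epsilon>\<^sup>2 - 8 / \<epsilon>\<^sup>2"
  proof -
    \<comment> \<open>The shift \<open>3 / \<epsilon>\<close> is chosen so that the cross term is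
      exactly \<open>6 * s / W ^ 4\<close>; the first square is at most
      \<open>G / W\<^sup>2\<close>.\<close>
    have "0 \<le> (\<epsilon> * s / W ^ 4 + 3 / \<epsilon>)\<^sup>2" by simp
    also have "\<dots> = (\<epsilon> * s)\<^sup>2 / W ^ 8 + 6 * s / W ^ 4 + 9 / \<epsilon>\<^sup>2"
      using \<epsilon> W by (simp add: power2_eq_square field_simps power_numeral_reduce)
    also have "(\<epsilon> * s)\<^sup>2 / W ^ 8 \<le> W ^ 6 * G / W ^ 8"
      using s by (intro divide_right_mono) auto
    also have "W ^ 6 * G / W ^ 8 = G / W\<^sup>2"
      using W by (simp add: field_simps power_numeral_reduce)
    finally have 1: "G / W\<^sup>2 + 6 * s / W ^ 4 \<ge> - 9 / \<epsilon>\<^sup>2" by simp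
    have "8 * (norm p)\<^sup>2 / W ^ 4 \<le> 8 * W\<^sup>2 / W ^ 4"
      using W by (intro divide_right_mono mult_left_mono power_mono) auto
    also have "\<dots> = 8 / W\<^sup>2" using W by (simp add: field_simps power_numeral_reduce)
    also have "\<dots> \<le> 8 / \<epsilon>\<^sup>2" using W \<epsilon> by (intro divide_left_mono power_mono) auto
    finally show ?thesis using 1 by simp
  qed
  finally show ?thesis by simp
qed

section \<open>The differentiated equation at a maximum point\<close>

lemma has_derivative_along_line:
  fixes f :: "'a::real_normed_vector \<Rightarrow> real"
  assumes "(f has_derivative f') (at (z + t *\<^sub>R v))"
  shows "((\<lambda>t. f (z + t *\<^sub>R v)) has_real_derivative f' v) (at t)"
proof -
  have "((\<lambda>t. z + t *\<^sub>R v) has_derivative (\<lambda>h. h *\<^sub>R v)) (at t)"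
    by (auto intro!: derivative_eq_intros)
  from has_derivative_compose[OF this assms] show ?thesis
    by (simp add: has_field_derivative_def linear_scale[OF has_derivative_linear[OF assms]]
        mult_commute_abs)
qed

text \<open>\<open>g\<close>, \<open>Q\<close>, \<open>T\<close> are the first three derivatives of \<open>u\<close>, \<open>h\<close> is the gradient of \<open>H\<close>, and \<open>J\<close> is the
  linear field \<open>X\<close>; the divergence has been carried out in \<open>eqn\<close>.\<close>

locale twisted_solution =
  fixes S :: "'a::euclidean_space set" and u H :: "'a \<Rightarrow> real" and g h :: "'a \<Rightarrow> 'a"
    and Q :: "'a \<Rightarrow> 'a \<Rightarrow> 'a" and T :: "'a \<Rightarrow> 'a \<Rightarrow> 'a \<Rightarrow> 'a" and J :: "'a \<Rightarrow> 'a" and \<epsilon> :: real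
  assumes S: "open S" and \<epsilon>: "\<epsilon> > 0"
    and J: "linear J" "\<And>x y. J x \<bullet> y = - (x \<bullet> J y)" "\<And>x. norm (J x) = norm x"
    and u: "\<And>z. z \<in> S \<Longrightarrow> (u has_derivative (\<lambda>v. g z \<bullet> v)) (at z)"
    and g: "\<And>z. z \<in> S \<Longrightarrow> (g has_derivative Q z) (at z)"
    and Q: "\<And>z v. z \<in> S \<Longrightarrow> ((\<lambda>z. Q z v) has_derivative T z v) (at z)"
    and H: "\<And>z. z \<in> S \<Longrightarrow> (H has_derivative (\<lambda>v. h z \<bullet> v)) (at z)"
    and eqn: "\<And>z. z \<in> S \<Longrightarrow> (\<Sum>b\<in>Basis. Q z b \<bullet> b)
        - (Q z (g z + J z) \<bullet> (g z + J z)) / (area_density \<epsilon> (g z + J z))\<^sup>2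
        = H z * area_density \<epsilon> (g z + J z)"
begin

definition p where "p z = g z + J z"
definition P where "P z v = Q z v + J v"
definition W where "W z = area_density \<epsilon> (p z)"

lemma W_bounds: "W z > 0" "W z \<ge> \<epsilon>" "W z \<ge> norm (p z)" "W z \<le> \<epsilon> + norm (p z)"
  using area_density_bounds[OF \<epsilon>] by (auto simp: W_def)

lemma W_square: "(W z)\<^sup>2 = \<epsilon>\<^sup>2 + p z \<bullet> p z"
  by (simp add: W_def area_density_square power2_norm_eq_inner)

lemma linear_Q: "z \<in> S \<Longrightarrow> linear (Q z)"
  using g has_derivative_linear by blast

lemma p_has_derivative: "z \<in> S \<Longrightarrow> (p has_derivative P z) (at z)"
  unfolding p_def P_def
  by (intro has_derivative_add g bounded_linear_imp_has_derivative)
     (use J(1) linear_conv_bounded_linear in auto)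

lemma P_has_derivative: "z \<in> S \<Longrightarrow> ((\<lambda>z. P z v) has_derivative T z v) (at z)"
  unfolding P_def using has_derivative_add[OF Q has_derivative_const] by simp

section \<open>Symmetries of the second and third derivatives\<close>

lemma Q_symmetric:
  assumes z: "z \<in> S"
  shows "Q z x \<bullet> y = x \<bullet> Q z y"
proof -
  have "((\<lambda>z. g z \<bullet> v) has_derivative (\<lambda>h. Q z h \<bullet> v)) (at z)" for v
    using g[OF z] by (rule has_derivative_inner_left)
  from second_derivative_symmetric[OF S z u this this] show ?thesis
    by (simp add: inner_commute)
qed

lemma T_symmetric:
  assumes z: "z \<in> S"
  shows "T z x y = T z y x"
proof (rule euclidean_eqI)
  fix b :: 'a
  have 1: "((\<lambda>z. g z \<bullet> b) has_derivative (\<lambda>v. Q z v \<bullet> b)) (at z)" if "z \<in> S" for z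
    using g[OF that] by (rule has_derivative_inner_left)
  have 2: "((\<lambda>z. Q z v \<bullet> b) has_derivative (\<lambda>h. T z v h \<bullet> b)) (at z)" for v
    using Q[OF z] by (rule has_derivative_inner_left)
  show "T z x y \<bullet> b = T z y x \<bullet> b"
    using second_derivative_symmetric[OF S z 1 2 2] .
qed

text \<open>Differentiates the symmetry of \<open>Q\<close>, which holds throughout a neighbourhood
  of \<open>z\<close>. Together with \<open>T_symmetric\<close> it makes the third derivative
  totally symmetric.\<close>

lemma T_inner_swap:
  assumes z: "z \<in> S"
  shows "T z x w \<bullet> y = T z y w \<bullet> x"
proof -
  have 1: "((\<lambda>z. Q z v \<bullet> b) has_derivative (\<lambda>h. T z v h \<bullet> b)) (at z)" for v b
    using Q[OF z] by (rule has_derivative_inner_left)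
  have "((\<lambda>z. Q z x \<bullet> y) has_derivative (\<lambda>h. T z y h \<bullet> x)) (at z)"
    by (rule has_derivative_transform_within_open[OF 1 S z]) (metis Q_symmetric inner_commute)
  with 1[of x y] show ?thesis
    using has_derivative_unique by metis
qed

text \<open>A derivative is linear in its last argument; \<open>T_symmetric\<close> moves this to
  the slot over which the frame trace is taken.\<close>

lemma bilinear_T_inner:
  assumes z: "z \<in> S"
  shows "bilinear (\<lambda>x y. T z x w \<bullet> y)"
proof -
  have "linear (T z w)" using Q[OF z] has_derivative_linear by blast
  then have "linear (\<lambda>x. T z x w)" by (simp only: T_symmetric[OF z, of _ w])
  from linear_add[OF this] linear_scale[OF this] show ?thesis
    unfolding bilinear_def
    by (auto intro!: linearI simp: inner_add_left inner_add_right)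
qed

lemma inner_p_P: "z \<in> S \<Longrightarrow> p z \<bullet> P z (p z) = p z \<bullet> Q z (p z)"
  using J(2)[of "p z" "p z"] by (simp add: P_def inner_add_right inner_commute)

section \<open>Differentiating the equation in the direction \<open>p\<close>\<close>

lemma W_square_has_derivative:
  assumes z: "z \<in> S"
  shows "((\<lambda>z. (W z)\<^sup>2) has_derivative (\<lambda>v. 2 * (p z \<bullet> P z v))) (at z)"
  unfolding W_square
  by (auto intro!: derivative_eq_intros p_has_derivative[OF z] simp: inner_commute)

lemma W_has_derivative:
  assumes z: "z \<in> S"
  shows "(W has_derivative (\<lambda>v. (p z \<bullet> P z v) / W z)) (at z)"
  unfolding W_def using has_derivative_area_density[OF _ p_has_derivative[OF z]] \<epsilon> by simp

text \<open>Differentiability of \<open>Q\<close> is given for fixed vector arguments, so the moving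
  argument \<open>p z\<close> is expanded in the basis before the product rule applies.\<close>

lemma Q_p_has_derivative:
  assumes z: "z \<in> S"
  shows "((\<lambda>z. Q z (p z)) has_derivative (\<lambda>v. T z (p z) v + Q z (P z v))) (at z)"
proof -
  have exp: "L x = (\<Sum>b\<in>Basis. (x \<bullet> b) *\<^sub>R L b)" if "linear L" for L :: "'a \<Rightarrow> 'a" and x
    using linear_sum[OF that, of "\<lambda>b. (x \<bullet> b) *\<^sub>R b" Basis] linear_scale[OF that]
    by (simp add: euclidean_representation)
  have "((\<lambda>x. \<Sum>b\<in>Basis. (p x \<bullet> b) *\<^sub>R Q x b) has_derivative
      (\<lambda>v. \<Sum>b\<in>Basis. (p z \<bullet> b) *\<^sub>R T z b v + (P z v \<bullet> b) *\<^sub>R Q z b)) (at z)"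
    by (intro has_derivative_sum has_derivative_scaleR Q[OF z]
        has_derivative_inner_left p_has_derivative[OF z])
  moreover have "(\<Sum>b\<in>Basis. (p z \<bullet> b) *\<^sub>R T z b v + (P z v \<bullet> b) *\<^sub>R Q z b) = T z (p z) v + Q z (P z v)" for v
  proof -
    have "linear (T z v)" using Q[OF z] has_derivative_linear by blast
    then have "T z (p z) v = (\<Sum>b\<in>Basis. (p z \<bullet> b) *\<^sub>R T z b v)"
      unfolding T_symmetric[OF z, of _ v] by (rule exp)
    then show ?thesis
      using exp[OF linear_Q[OF z], of "P z v"] by (simp add: sum.distrib)
  qed
  ultimately have "((\<lambda>x. \<Sum>b\<in>Basis. (p x \<bullet> b) *\<^sub>R Q x b) has_derivative
      (\<lambda>v. T z (p z) v + Q z (P z v))) (at z)" by simp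
  then show ?thesis
    by (rule has_derivative_transform_within_open[OF _ S z]) (use exp[OF linear_Q] in metis)
qed

text \<open>The left side is the third order trace that appears in the second order condition for
  \<open>W\<^sup>2\<close>; the right side involves at most second derivatives of
  \<open>u\<close>.\<close>

lemma differentiated_equation:
  assumes z: "z \<in> S"
  shows "(\<Sum>b\<in>Basis. T z b (p z) \<bullet> b) - (T z (p z) (p z) \<bullet> p z) / (W z)\<^sup>2
    = (h z \<bullet> p z) * W z + H z * (p z \<bullet> Q z (p z)) / W z
      + 2 * (P z (p z) \<bullet> Q z (p z)) / (W z)\<^sup>2 - 2 * (p z \<bullet> Q z (p z))\<^sup>2 / (W z) ^ 4"
proof -
  define v where "v = p z"
  \<comment> \<open>The equation times \<open>W\<^sup>2\<close>, free of quotients. The cube is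
    written \<open>W x * (W x)\<^sup>2\<close> to fit the two derivative rules for
    \<open>W\<close>.\<close>
  define F where "F x = (\<Sum>b\<in>Basis. Q x b \<bullet> b) * (W x)\<^sup>2 - Q x (p x) \<bullet> p x - H x * (W x * (W x)\<^sup>2)" for x
  have W: "W z > 0" by (rule W_bounds)
  define F' where "F' = (\<lambda>v. (\<Sum>b\<in>Basis. Q z b \<bullet> b) * (2 * (p z \<bullet> P z v)) + (\<Sum>b\<in>Basis. T z b v \<bullet> b) * (W z)\<^sup>2
     - (Q z (p z) \<bullet> P z v + (T z (p z) v + Q z (P z v)) \<bullet> p z)
     - (H z * (W z * (2 * (p z \<bullet> P z v)) + (p z \<bullet> P z v) / W z * (W z)\<^sup>2) + (h z \<bullet> v) * (W z * (W z)\<^sup>2)))"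
  have "(F has_derivative F') (at z)"
    unfolding F_def F'_def
    by (intro has_derivative_diff has_derivative_mult has_derivative_inner has_derivative_inner_left
        has_derivative_sum W_has_derivative W_square_has_derivative Q_p_has_derivative
        p_has_derivative H Q z)
  moreover have "F x = 0" if "x \<in> S" for x
  proof -
    have "F x = (W x)\<^sup>2 * ((\<Sum>b\<in>Basis. Q x b \<bullet> b) - (Q x (p x) \<bullet> p x) / (W x)\<^sup>2 - H x * W x)"
      using W_bounds(1)[of x] by (simp add: F_def field_simps)
    then show ?thesis using eqn[OF that] by (simp add: p_def W_def)
  qed
  then have "(F has_derivative (\<lambda>v. 0)) (at z)"
    by (intro has_derivative_transform_within_open[OF has_derivative_const S z]) auto
  ultimately have "F' v = 0" using has_derivative_unique by metis
  define q where "q = p z \<bullet> Q z v"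
  have pP: "p z \<bullet> P z v = q" using inner_p_P[OF z] by (simp add: v_def q_def)
  \<comment> \<open>The undifferentiated equation eliminates the trace of \<open>Q\<close>; this
    produces the term \<open>- 2 * q\<^sup>2 / W ^ 4\<close>.\<close>
  have e: "(\<Sum>b\<in>Basis. Q z b \<bullet> b) = H z * W z + q / (W z)\<^sup>2"
    using eqn[OF z] by (simp add: p_def W_def v_def q_def inner_commute)
  have s: "Q z (p z) \<bullet> P z v + (T z (p z) v + Q z (P z v)) \<bullet> p z
     = 2 * (P z v \<bullet> Q z v) + T z v v \<bullet> v"
    using Q_symmetric[OF z, of "P z v" v] 
    by (simp add: v_def inner_add_left inner_commute[of "Q z (p z)"])
  have "(\<Sum>b\<in>Basis. T z b v \<bullet> b) * (W z)\<^sup>2 = 2 * (P z v \<bullet> Q z v) + T z v v \<bullet> v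
     + (H z * (W z * (2 * q) + q / W z * (W z)\<^sup>2) + (h z \<bullet> v) * (W z * (W z)\<^sup>2))
     - (H z * W z + q / (W z)\<^sup>2) * (2 * q)"
    using \<open>F' v = 0\<close> unfolding F'_def pP e s by linarith
  then have "(\<Sum>b\<in>Basis. T z b v \<bullet> b) = (2 * (P z v \<bullet> Q z v) + T z v v \<bullet> v
     + (H z * (W z * (2 * q) + q / W z * (W z)\<^sup>2) + (h z \<bullet> v) * (W z * (W z)\<^sup>2))
     - (H z * W z + q / (W z)\<^sup>2) * (2 * q)) / (W z)\<^sup>2"
    using W by (simp add: eq_divide_eq)
  then show ?thesis
    unfolding v_def[symmetric] q_def[symmetric]
    using W by (simp add: divide_simps power_numeral_reduce) (simp add: algebra_simps q_def v_def)
qed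

text \<open>The maximum conditions hold along every line through \<open>z\<close>. Summed over the
  directions \<open>shrink \<epsilon> (p z) b\<close>, the second order ones become traces against
  \<open>A\<close>; the differentiated equation removes the third derivatives, and
  \<open>commutator_terms_bound\<close> handles what is quadratic in the second derivatives.\<close>

lemma local_max_inequality:
  fixes \<phi> :: "'a \<Rightarrow> real" and a :: "'a \<Rightarrow> 'a"
  assumes z: "z \<in> S" and r: "r > 0" "ball z r \<subseteq> S" and K: "K > 0"
    and \<phi>: "\<And>x. x \<in> ball z r \<Longrightarrow> (\<phi> has_derivative (\<lambda>v. a x \<bullet> v)) (at x)"
    and a: "(a has_derivative a') (at z)"
    and pos: "\<phi> z > 0"
    and max: "\<And>x. x \<in> ball z r \<Longrightarrow> (W x)\<^sup>2 * (exp (K * \<phi> x) - 1)\<^sup>2 \<le> (W z)\<^sup>2 * (exp (K * \<phi> z) - 1)\<^sup>2"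
  shows "K * ((\<Sum>b\<in>Basis. a' (shrink \<epsilon> (p z) b) \<bullet> shrink \<epsilon> (p z) b)
      + K * (\<Sum>b\<in>Basis. (a z \<bullet> shrink \<epsilon> (p z) b)\<^sup>2) - H z * (a z \<bullet> p z) / W z) \<le> norm (h z) + 17 / \<epsilon>\<^sup>2"
proof -
  define E where "E = exp (K * \<phi> z)"
  define \<eta> where "\<eta> = E - 1"
  have \<eta>: "\<eta> > 0" "\<eta> \<le> E" "E > 0" using pos K by (auto simp: \<eta>_def E_def)
  have W: "W z > 0" by (rule W_bounds)
  have line: "2 * (p z \<bullet> P z v) * \<eta> = - 2 * (W z)\<^sup>2 * (K * E * (a z \<bullet> v))
    \<and> (norm (P z v))\<^sup>2 / (W z)\<^sup>2 + (T z v (p z) \<bullet> v) / (W z)\<^sup>2 - 3 * (p z \<bullet> P z v)\<^sup>2 / (W z) ^ 4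
     + K * E * (a' v \<bullet> v + K * (a z \<bullet> v)\<^sup>2) / \<eta> \<le> 0" for v
  proof -
    define r' where "r' = r / (norm v + 1)"
    have nv: "norm v + 1 > 0" by (smt (verit) norm_ge_zero)
    have r': "r' > 0" using r nv by (simp add: r'_def)
    have inball: "z + t *\<^sub>R v \<in> ball z r" if "\<bar>t\<bar> < r'" for t
    proof -
      have "\<bar>t\<bar> * norm v \<le> \<bar>t\<bar> * (norm v + 1)" by (intro mult_left_mono) auto
      also have "\<dots> < r" using that nv by (simp add: r'_def field_simps)
      finally show ?thesis by (simp add: dist_norm)
    qed
    have w: "((\<lambda>t. (W (z + t *\<^sub>R v))\<^sup>2) has_real_derivative 2 * (p (z + t *\<^sub>R v) \<bullet> P (z + t *\<^sub>R v) v)) (at t)"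
      if "\<bar>t\<bar> < r'" for t
      using inball[OF that] r(2)
      by (intro has_derivative_along_line[OF W_square_has_derivative]) auto
    have w2: "((\<lambda>t. 2 * (p (z + t *\<^sub>R v) \<bullet> P (z + t *\<^sub>R v) v)) has_real_derivative
        2 * (p z \<bullet> T z v v + P z v \<bullet> P z v)) (at 0)"
    proof -
      have "((\<lambda>x. 2 * (p x \<bullet> P x v)) has_derivative
         (\<lambda>k. 2 * (p z \<bullet> T z v k + P z k \<bullet> P z v))) (at (z + 0 *\<^sub>R v))"
        using has_derivative_mult_right[OF has_derivative_inner[OF p_has_derivative[OF z] P_has_derivative[OF z, of v]], of 2]
        by (simp only: scaleR_zero_left add_0_right)
      from has_derivative_along_line[OF this] show ?thesis .
    qed
    have e: "((\<lambda>t. exp (K * \<phi> (z + t *\<^sub>R v)) - 1) has_real_derivative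
        exp (K * \<phi> (z + t *\<^sub>R v)) * (K * (a (z + t *\<^sub>R v) \<bullet> v))) (at t)" if "\<bar>t\<bar> < r'" for t
      using has_derivative_along_line[OF \<phi>[OF inball[OF that]]]
      by (auto intro!: derivative_eq_intros)
    have e2: "((\<lambda>t. exp (K * \<phi> (z + t *\<^sub>R v)) * (K * (a (z + t *\<^sub>R v) \<bullet> v))) has_real_derivative
        K * E * (a' v \<bullet> v + K * (a z \<bullet> v)\<^sup>2)) (at 0)"
    proof -
      have 1: "((\<lambda>t. a (z + t *\<^sub>R v) \<bullet> v) has_real_derivative a' v \<bullet> v) (at 0)"
        by (rule has_derivative_along_line) (use has_derivative_inner_left[OF a, of v] in simp)
      have 2: "((\<lambda>t. \<phi> (z + t *\<^sub>R v)) has_real_derivative a z \<bullet> v) (at 0)"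
        using has_derivative_along_line[of \<phi> "\<lambda>v. a z \<bullet> v" z 0 v] \<phi>[of z] r by simp
      show ?thesis
        by (rule derivative_eq_intros 1 2 refl)+ (simp add: E_def power2_eq_square algebra_simps)
    qed
    have m: "(W (z + t *\<^sub>R v))\<^sup>2 * (exp (K * \<phi> (z + t *\<^sub>R v)) - 1)\<^sup>2
       \<le> (W (z + 0 *\<^sub>R v))\<^sup>2 * (exp (K * \<phi> (z + 0 *\<^sub>R v)) - 1)\<^sup>2" if "\<bar>t\<bar> < r'" for t
      using max[OF inball[OF that]] by simp
    have 1: "2 * (p z \<bullet> P z v) * \<eta> = - 2 * (W z)\<^sup>2 * (K * E * (a z \<bullet> v))"
      using weighted_square_local_max(1)[OF r' w w2 e e2 m] W \<eta>
      by (simp add: \<eta>_def E_def mult_ac)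
    have "2 * (p z \<bullet> T z v v + P z v \<bullet> P z v) / (2 * (W z)\<^sup>2)
        - 3 / 4 * (2 * (p z \<bullet> P z v) / (W z)\<^sup>2)\<^sup>2 + K * E * (a' v \<bullet> v + K * (a z \<bullet> v)\<^sup>2) / \<eta> \<le> 0"
      using weighted_square_local_max(2)[OF r' w w2 e e2 m] W \<eta>
      by (simp add: \<eta>_def E_def)
    \<comment> \<open>Total symmetry brings the third derivative into the form used in
      \<open>differentiated_equation\<close>.\<close>
    moreover have "p z \<bullet> T z v v = T z v (p z) \<bullet> v"
      using T_inner_swap[OF z, of v v "p z"] T_symmetric[OF z, of "p z" v] by (simp add: inner_commute)
    ultimately have "(norm (P z v))\<^sup>2 / (W z)\<^sup>2 + (T z v (p z) \<bullet> v) / (W z)\<^sup>2 - 3 * (p z \<bullet> P z v)\<^sup>2 / (W z) ^ 4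
     + K * E * (a' v \<bullet> v + K * (a z \<bullet> v)\<^sup>2) / \<eta> \<le> 0"
      by (simp add: power2_norm_eq_inner add_divide_distrib power_divide power_mult_distrib
          flip: power_mult)
    with 1 show ?thesis by simp
  qed
  define B where "B = shrink \<epsilon> (p z)"
  define Y where "Y = (\<Sum>b\<in>Basis. a' (B b) \<bullet> B b) + K * (\<Sum>b\<in>Basis. (a z \<bullet> B b)\<^sup>2)"
  have "(\<Sum>b\<in>Basis. (norm (P z (B b)))\<^sup>2 / (W z)\<^sup>2 + (T z (B b) (p z) \<bullet> B b) / (W z)\<^sup>2 - 3 * (p z \<bullet> P z (B b))\<^sup>2 / (W z) ^ 4
     + K * E * (a' (B b) \<bullet> B b + K * (a z \<bullet> B b)\<^sup>2) / \<eta>) \<le> 0"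
    by (intro sum_nonpos) (use line in blast)
  also have "(\<Sum>b\<in>Basis. (norm (P z (B b)))\<^sup>2 / (W z)\<^sup>2 + (T z (B b) (p z) \<bullet> B b) / (W z)\<^sup>2 - 3 * (p z \<bullet> P z (B b))\<^sup>2 / (W z) ^ 4
     + K * E * (a' (B b) \<bullet> B b + K * (a z \<bullet> B b)\<^sup>2) / \<eta>)
     = (\<Sum>b\<in>Basis. (norm (P z (B b)))\<^sup>2 / (W z)\<^sup>2 - 3 * (p z \<bullet> P z (B b))\<^sup>2 / (W z) ^ 4)
      + (\<Sum>b\<in>Basis. T z (B b) (p z) \<bullet> B b) / (W z)\<^sup>2 + K * E * Y / \<eta>"
    by (simp add: Y_def sum.distrib sum_subtractf sum_divide_distrib sum_distrib_left
        add_divide_distrib distrib_left mult_ac)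
  also have "(\<Sum>b\<in>Basis. T z (B b) (p z) \<bullet> B b) =
      (h z \<bullet> p z) * W z + H z * (p z \<bullet> Q z (p z)) / W z
      + 2 * (P z (p z) \<bullet> Q z (p z)) / (W z)\<^sup>2 - 2 * (p z \<bullet> Q z (p z))\<^sup>2 / (W z) ^ 4"
    unfolding B_def sum_shrink_frame[OF \<epsilon> bilinear_T_inner[OF z]]
    using differentiated_equation[OF z] by (simp add: W_def)
  also have "((h z \<bullet> p z) * W z + H z * (p z \<bullet> Q z (p z)) / W z
      + 2 * (P z (p z) \<bullet> Q z (p z)) / (W z)\<^sup>2 - 2 * (p z \<bullet> Q z (p z))\<^sup>2 / (W z) ^ 4) / (W z)\<^sup>2
     = (h z \<bullet> p z) / W z + H z * (p z \<bullet> Q z (p z)) / W z ^ 3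
      + 2 * (P z (p z) \<bullet> Q z (p z)) / (W z) ^ 4 - 2 * (p z \<bullet> Q z (p z))\<^sup>2 / (W z) ^ 6"
    using W by (simp add: field_simps power_numeral_reduce)
  finally have main: "((\<Sum>b\<in>Basis. (norm (P z (B b)))\<^sup>2 / (W z)\<^sup>2 - 3 * (p z \<bullet> P z (B b))\<^sup>2 / (W z) ^ 4)
      + 2 * (P z (p z) \<bullet> Q z (p z)) / (W z) ^ 4 - 2 * (p z \<bullet> Q z (p z))\<^sup>2 / (W z) ^ 6)
      + (h z \<bullet> p z) / W z + H z * (p z \<bullet> Q z (p z)) / W z ^ 3 + K * E * Y / \<eta> \<le> 0"
    by linarith
  have c: "(\<Sum>b\<in>Basis. (norm (P z (B b)))\<^sup>2 / (W z)\<^sup>2 - 3 * (p z \<bullet> P z (B b))\<^sup>2 / (W z) ^ 4)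
      + 2 * (P z (p z) \<bullet> Q z (p z)) / (W z) ^ 4 - 2 * (p z \<bullet> Q z (p z))\<^sup>2 / (W z) ^ 6 \<ge> - 17 / \<epsilon>\<^sup>2"
    using commutator_terms_bound[OF \<epsilon> linear_Q[OF z] Q_symmetric[OF z] J, of "p z"]
    by (simp add: B_def W_def P_def)
  have hp: "(h z \<bullet> p z) / W z \<ge> - norm (h z)"
  proof -
    have "- (h z \<bullet> p z) \<le> norm (h z) * norm (p z)"
      using Cauchy_Schwarz_ineq2[of "h z" "p z"] by linarith
    also have "\<dots> \<le> norm (h z) * W z" by (intro mult_left_mono W_bounds) auto
    finally show ?thesis using W by (simp add: field_simps)
  qed
  \<comment> \<open>The first order condition along \<open>p\<close> itself trades this second
    derivative for \<open>a z \<bullet> p z\<close>, so that the term with \<open>H\<close> acquires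
    the common factor \<open>K * E / \<eta>\<close>.\<close>
  have pQ: "p z \<bullet> Q z (p z) = - ((W z)\<^sup>2 * (K * E * (a z \<bullet> p z))) / \<eta>"
    using line[of "p z"] inner_p_P[OF z] \<eta> by (simp add: field_simps)
  have "H z * (p z \<bullet> Q z (p z)) / W z ^ 3 = - (K * E / \<eta> * (H z * (a z \<bullet> p z) / W z))"
    unfolding pQ using W \<eta> by (simp add: field_simps power_numeral_reduce)
  then have "E / \<eta> * (K * (Y - H z * (a z \<bullet> p z) / W z)) \<le> norm (h z) + 17 / \<epsilon>\<^sup>2"
    using main c hp by (simp add: algebra_simps)
  moreover have "K * (Y - H z * (a z \<bullet> p z) / W z) \<le> max 0 (E / \<eta> * (K * (Y - H z * (a z \<bullet> p z) / W z)))"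
    (is "?y \<le> max 0 (?c * ?y)")
  proof (cases "?y \<le> 0")
    case False
    have "1 * ?y \<le> ?c * ?y" using False \<eta> by (intro mult_right_mono) (auto simp: field_simps)
    then show ?thesis by simp
  qed auto
  moreover have "0 \<le> norm (h z) + 17 / \<epsilon>\<^sup>2" by simp
  ultimately have "K * (Y - H z * (a z \<bullet> p z) / W z) \<le> norm (h z) + 17 / \<epsilon>\<^sup>2"
    by linarith
  then show ?thesis by (simp add: Y_def B_def)
qed

end

section \<open>The interior estimate\<close>

text \<open>Large enough that \<open>(u x - u z0) / c \<le> 1 / 2\<close> when
  \<open>|u| \<le> Mu\<close>; the summand 1 keeps it positive for \<open>Mu = 0\<close>.\<close>

definition barrier_scale :: "real \<Rightarrow> real" where
  "barrier_scale Mu = 4 * (Mu + 1)"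

text \<open>From this size of \<open>p\<close> on, \<open>Du\<close> dominates \<open>X\<close> and
  the gradient of the quadratic part of \<open>\<phi>\<close>, giving
  \<open>|D\<phi>| \<ge> |p| / (2 * c)\<close> and \<open>|p| \<ge> \<epsilon>\<close>.\<close>

definition steep_threshold :: "real \<Rightarrow> real \<Rightarrow> real \<Rightarrow> real \<Rightarrow> real" where
  "steep_threshold \<epsilon> R Mu MX = 2 * (MX + 4 * barrier_scale Mu / R) + \<epsilon>"

text \<open>Of the form \<open>(C1 + C2 + 1) / \<delta> + 1\<close>: \<open>C1\<close> bounds the
  right side of the maximum inequality, \<open>- C2\<close> bounds the trace and \<open>H\<close>
  terms from below, and \<open>\<delta>\<close> bounds
  \<open>\<langle>A D\<phi>, D\<phi>\<rangle>\<close> from below. Hence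
  \<open>K * \<delta> - C2 > C1\<close> and \<open>K \<ge> 1\<close>.\<close>

definition barrier_exponent :: "nat \<Rightarrow> real \<Rightarrow> real \<Rightarrow> real \<Rightarrow> real \<Rightarrow> real \<Rightarrow> real" where
  "barrier_exponent N \<epsilon> R Mu MH MX =
    ((MH + 17 / \<epsilon>\<^sup>2) + (MH / barrier_scale Mu * (\<epsilon> + MX) + 4 * N / R\<^sup>2 + 4 * MH / R) + 1)
      / (\<epsilon>\<^sup>2 / (8 * (barrier_scale Mu)\<^sup>2)) + 1"

text \<open>A bound for the maximum of \<open>W * \<eta>\<close>, using
  \<open>\<phi> \<le> 3 / 2\<close>, divided by the value of \<open>\<eta>\<close> at the centre,
  where \<open>\<phi> = 1\<close>. The last \<open>MX\<close> passes from \<open>Du + X\<close> to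
  \<open>Du\<close>.\<close>

definition gradient_bound :: "nat \<Rightarrow> real \<Rightarrow> real \<Rightarrow> real \<Rightarrow> real \<Rightarrow> real \<Rightarrow> real" where
  "gradient_bound N \<epsilon> R Mu MH MX =
    (\<epsilon> + steep_threshold \<epsilon> R Mu MX) * (exp (barrier_exponent N \<epsilon> R Mu MH MX * (3 / 2)) - 1)
      / (exp (barrier_exponent N \<epsilon> R Mu MH MX) - 1) + MX"

context twisted_solution
begin

text \<open>For steep \<open>p\<close> the bracket in \<open>local_max_inequality\<close> is at
  least \<open>C1 + 1\<close>, while that lemma bounds \<open>K \<ge> 1\<close> times the bracket by
  \<open>C1\<close>.\<close>

lemma interior_max_not_steep:
  assumes z: "z \<in> S" and r: "r > 0" "ball z r \<subseteq> S" and R: "R > 0"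
    and Mu: "Mu \<ge> 0" and near: "norm (z - z0) \<le> R" and MX: "norm z \<le> MX"
    and MH: "\<bar>H z\<bar> \<le> MH" "norm (h z) \<le> MH"
    and \<phi>: "\<phi> = (\<lambda>x. (u x - u z0) / barrier_scale Mu + 1 - 2 * ((x - z0) \<bullet> (x - z0)) / R\<^sup>2)"
    and K: "K = barrier_exponent DIM('a) \<epsilon> R Mu MH MX"
    and pos: "\<phi> z > 0"
    and max: "\<And>x. x \<in> ball z r \<Longrightarrow> (W x)\<^sup>2 * (exp (K * \<phi> x) - 1)\<^sup>2 \<le> (W z)\<^sup>2 * (exp (K * \<phi> z) - 1)\<^sup>2"
  shows "norm (p z) < steep_threshold \<epsilon> R Mu MX"
proof (rule ccontr)
  assume "\<not> norm (p z) < steep_threshold \<epsilon> R Mu MX"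
  define c where "c = barrier_scale Mu"
  have c: "c > 0" using Mu by (simp add: c_def barrier_scale_def)
  have W: "W z > 0" by (rule W_bounds)
  have MX0: "MX \<ge> 0" using MX norm_ge_zero[of z] by linarith
  have MH0: "MH \<ge> 0" using MH by linarith
  have steep: "norm (p z) \<ge> 2 * (MX + 4 * c / R) + \<epsilon>"
    using \<open>\<not> _\<close> by (simp add: steep_threshold_def c_def)
  define \<delta> where "\<delta> = \<epsilon>\<^sup>2 / (8 * c\<^sup>2)"
  have \<delta>: "\<delta> > 0" using \<epsilon> c by (simp add: \<delta>_def)
  define C1 where "C1 = MH + 17 / \<epsilon>\<^sup>2"
  define C2 where "C2 = MH / c * (\<epsilon> + MX) + 4 * DIM('a) / R\<^sup>2 + 4 * MH / R"
  have C1: "C1 \<ge> 0" using MH0 by (simp add: C1_def)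
  have C2: "C2 \<ge> 0" using MH0 MX0 \<epsilon> c R by (simp add: C2_def)
  have K': "K = (C1 + C2 + 1) / \<delta> + 1"
    by (simp add: K barrier_exponent_def C1_def C2_def \<delta>_def c_def)
  have K1: "K \<ge> 1" using C1 C2 \<delta> by (simp add: K')
  define a where "a x = (1 / c) *\<^sub>R g x - (4 / R\<^sup>2) *\<^sub>R (x - z0)" for x
  define a' where "a' v = (1 / c) *\<^sub>R Q z v - (4 / R\<^sup>2) *\<^sub>R v" for v
  have d\<phi>: "(\<phi> has_derivative (\<lambda>v. a x \<bullet> v)) (at x)" if "x \<in> ball z r" for x
  proof -
    have "(u has_derivative (\<lambda>v. g x \<bullet> v)) (at x)" using u r(2) that by blast
    then have du: "((\<lambda>x. u x - u z0) has_derivative (\<lambda>v. g x \<bullet> v)) (at x)"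
      by (auto intro!: derivative_eq_intros)
    have dn: "((\<lambda>x. (x - z0) \<bullet> (x - z0)) has_derivative (\<lambda>v. 2 * ((x - z0) \<bullet> v))) (at x)"
      by (auto intro!: derivative_eq_intros simp: inner_commute)
    have "((\<lambda>x. 1 / c * (u x - u z0) + 1 - 2 / R\<^sup>2 * ((x - z0) \<bullet> (x - z0))) has_derivative
        (\<lambda>v. 1 / c * (g x \<bullet> v) - 2 / R\<^sup>2 * (2 * ((x - z0) \<bullet> v)))) (at x)"
      by (intro has_derivative_diff has_derivative_add_const has_derivative_mult_right du dn)
    then show ?thesis
      by (simp add: \<phi> a_def inner_diff_left flip: c_def)
  qed
  have da: "(a has_derivative a') (at z)"
    unfolding a_def a'_def by (auto intro!: derivative_eq_intros g[OF z])
  define B where "B = shrink \<epsilon> (p z)"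
  define Y1 where "Y1 = (\<Sum>b\<in>Basis. a' (B b) \<bullet> B b)"
  define Y2 where "Y2 = (\<Sum>b\<in>Basis. (a z \<bullet> B b)\<^sup>2)"
  have key: "K * (Y1 + K * Y2 - H z * (a z \<bullet> p z) / W z) \<le> C1"
    using local_max_inequality[OF z r _ d\<phi> da pos max] K1 MH(2)
    unfolding Y1_def Y2_def B_def C1_def by force
  \<comment> \<open>The form of \<open>A\<close> is at least
    \<open>\<epsilon>\<^sup>2 / W\<^sup>2\<close> times the square norm. Steepness gives
    \<open>|a| \<ge> |p| / (2 * c)\<close> and \<open>W\<^sup>2 \<le> 2 * |p|\<^sup>2\<close>, and
    the powers of \<open>|p|\<close> cancel.\<close>
  have Y2: "Y2 \<ge> \<delta>"
  proof -
    have "norm (g z) \<ge> norm (p z) - MX"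
      using norm_triangle_ineq[of "g z" "J z"] MX by (simp add: p_def J(3))
    then have gz: "norm (g z) / c \<ge> (norm (p z) - MX) / c"
      using c by (simp add: divide_right_mono)
    have "norm (g z) / c \<le> norm (a z) + 4 / R\<^sup>2 * norm (z - z0)"
      using norm_triangle_ineq[of "a z" "(4 / R\<^sup>2) *\<^sub>R (z - z0)"] c by (simp add: a_def)
    also have "4 / R\<^sup>2 * norm (z - z0) \<le> 4 / R\<^sup>2 * R"
      using near by (intro mult_left_mono) auto
    finally have az: "norm (a z) \<ge> (norm (p z) - MX) / c - 4 / R"
      using gz R by (simp add: power2_eq_square)
    have "(norm (p z) - MX) / c - 4 / R = (norm (p z) - (MX + 4 * c / R)) / c"
      using c R by (simp add: field_simps)
    also have "\<dots> \<ge> (norm (p z) / 2) / c"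
      using steep c \<epsilon> by (intro divide_right_mono) auto
    finally have "norm (a z) \<ge> norm (p z) / (2 * c)" using az by simp
    then have na: "(norm (a z))\<^sup>2 \<ge> (norm (p z))\<^sup>2 / (4 * c\<^sup>2)"
      using power_mono[of "norm (p z) / (2 * c)" "norm (a z)" 2] c
      by (simp add: power_divide power_mult_distrib)
    have "norm (p z) \<ge> \<epsilon>"
      using steep MX0 c R by (smt (verit) divide_nonneg_pos)
    then have "\<epsilon>\<^sup>2 \<le> (norm (p z))\<^sup>2" using \<epsilon> by (intro power_mono) auto
    then have W2: "(W z)\<^sup>2 \<le> 2 * (norm (p z))\<^sup>2"
      by (simp add: W_square power2_norm_eq_inner)
    have "(a z \<bullet> p z)\<^sup>2 \<le> (norm (a z))\<^sup>2 * (norm (p z))\<^sup>2"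
      using Cauchy_Schwarz_ineq[of "a z" "p z"] by (simp add: power2_norm_eq_inner)
    then have "(a z \<bullet> p z)\<^sup>2 / (W z)\<^sup>2 \<le> (norm (a z))\<^sup>2 * (norm (p z))\<^sup>2 / (W z)\<^sup>2"
      by (intro divide_right_mono) auto
    moreover have "(norm (a z))\<^sup>2 - (norm (a z))\<^sup>2 * (norm (p z))\<^sup>2 / (W z)\<^sup>2 = (norm (a z))\<^sup>2 * \<epsilon>\<^sup>2 / (W z)\<^sup>2"
    proof -
      have n: "(norm (p z))\<^sup>2 = (W z)\<^sup>2 - \<epsilon>\<^sup>2" by (simp add: W_square power2_norm_eq_inner)
      show ?thesis unfolding n using W by (simp add: field_simps)
    qed
    ultimately have "Y2 \<ge> (norm (a z))\<^sup>2 * \<epsilon>\<^sup>2 / (W z)\<^sup>2"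
      unfolding Y2_def B_def sum_shrink_inner[OF \<epsilon>] by (simp add: W_def)
    moreover have "(norm (a z))\<^sup>2 * \<epsilon>\<^sup>2 / (W z)\<^sup>2 \<ge> \<delta>"
    proof -
      have "\<delta> * (W z)\<^sup>2 \<le> \<delta> * (2 * (norm (p z))\<^sup>2)" using W2 \<delta> by simp
      also have "\<dots> = (norm (p z))\<^sup>2 / (4 * c\<^sup>2) * \<epsilon>\<^sup>2" by (simp add: \<delta>_def)
      also have "\<dots> \<le> (norm (a z))\<^sup>2 * \<epsilon>\<^sup>2" using na by (intro mult_right_mono) auto
      finally show ?thesis using W by (simp add: le_divide_eq)
    qed
    ultimately show ?thesis by simp
  qed
  have low: "Y1 - H z * (a z \<bullet> p z) / W z \<ge> - C2"
  proof -
    have bil: "bilinear (\<lambda>x y. Q z x \<bullet> y)"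
      using linear_add[OF linear_Q[OF z]] linear_scale[OF linear_Q[OF z]]
      unfolding bilinear_def by (auto intro!: linearI simp: inner_add_left inner_add_right)
    have trQ: "(\<Sum>b\<in>Basis. Q z (B b) \<bullet> B b) = H z * W z"
      unfolding B_def sum_shrink_frame[OF \<epsilon> bil] using eqn[OF z] by (simp add: W_def p_def)
    have "(\<Sum>b\<in>Basis. B b \<bullet> B b) \<le> (\<Sum>b\<in>(Basis::'a set). 1)"
    proof (rule sum_mono)
      fix b :: 'a assume "b \<in> Basis"
      then show "B b \<bullet> B b \<le> 1"
        using norm_shrink_square[OF \<epsilon>, of "p z" b] by (simp add: B_def power2_norm_eq_inner)
    qed
    then have "(\<Sum>b\<in>Basis. B b \<bullet> B b) \<le> DIM('a)" by simp
    then have tr: "4 / R\<^sup>2 * (\<Sum>b\<in>Basis. B b \<bullet> B b) \<le> 4 / R\<^sup>2 * DIM('a)"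
      by (intro mult_left_mono) auto
    have Y1: "Y1 = H z * W z / c - 4 / R\<^sup>2 * (\<Sum>b\<in>Basis. B b \<bullet> B b)"
      unfolding Y1_def a'_def trQ[symmetric]
      by (simp add: inner_diff_left sum_subtractf sum_divide_distrib sum_distrib_left)
    have ap: "a z \<bullet> p z = (p z \<bullet> p z - J z \<bullet> p z) / c - 4 / R\<^sup>2 * ((z - z0) \<bullet> p z)"
      by (simp add: a_def p_def inner_diff_left inner_add_left inner_add_right
          add_divide_distrib diff_divide_distrib)
    \<comment> \<open>Each term alone may grow like \<open>W\<close>, but the leading part
      \<open>|p|\<^sup>2 / c\<close> of \<open>a z \<bullet> p z\<close> cancels this growth and
      leaves bounded quantities.\<close>
    have "H z * W z / c - H z * (a z \<bullet> p z) / W z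
      = H z * (\<epsilon>\<^sup>2 / W z) / c + H z * ((J z \<bullet> p z) / W z) / c + H z * (4 / R\<^sup>2 * (((z - z0) \<bullet> p z) / W z))"
    proof -
      have pp: "p z \<bullet> p z = W z * W z - \<epsilon>\<^sup>2" using W_square[of z] by (simp add: power2_eq_square)
      show ?thesis unfolding ap pp using W c R by (simp add: field_simps)
    qed
    moreover have inner_le: "\<bar>(x \<bullet> p z) / W z\<bar> \<le> norm x" for x
    proof -
      have "\<bar>x \<bullet> p z\<bar> \<le> norm x * norm (p z)" by (rule Cauchy_Schwarz_ineq2)
      also have "\<dots> \<le> norm x * W z" by (intro mult_left_mono W_bounds) auto
      finally show ?thesis using W by (simp add: field_simps)
    qed
    have prod: "H z * y \<ge> - (MH * m)" if "\<bar>y\<bar> \<le> m" for y m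
    proof -
      have "\<bar>H z * y\<bar> \<le> MH * m"
        unfolding abs_mult using that MH MH0 by (intro mult_mono) auto
      then show ?thesis by linarith
    qed
    have "\<epsilon>\<^sup>2 / W z \<le> \<epsilon>"
      using W_bounds(2)[of z] W \<epsilon> by (simp add: power2_eq_square divide_le_eq)
    then have "H z * (\<epsilon>\<^sup>2 / W z) / c \<ge> - (MH * \<epsilon>) / c"
      using W \<epsilon> c by (intro divide_right_mono prod) auto
    moreover have "H z * ((J z \<bullet> p z) / W z) / c \<ge> - (MH * MX) / c"
      using inner_le[of "J z"] MX c by (intro divide_right_mono prod) (auto simp: J(3))
    moreover have "H z * (4 / R\<^sup>2 * (((z - z0) \<bullet> p z) / W z)) \<ge> - (MH * (4 / R\<^sup>2 * R))"
    proof (rule prod)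
      have "\<bar>4 / R\<^sup>2 * (((z - z0) \<bullet> p z) / W z)\<bar> = 4 / R\<^sup>2 * \<bar>((z - z0) \<bullet> p z) / W z\<bar>"
        by (simp add: abs_mult)
      also have "\<dots> \<le> 4 / R\<^sup>2 * R"
        using inner_le[of "z - z0"] near by (intro mult_left_mono) auto
      finally show "\<bar>4 / R\<^sup>2 * (((z - z0) \<bullet> p z) / W z)\<bar> \<le> 4 / R\<^sup>2 * R" .
    qed
    moreover have "C2 = MH * \<epsilon> / c + MH * MX / c + 4 / R\<^sup>2 * DIM('a) + MH * (4 / R\<^sup>2 * R)"
      using c R by (simp add: C2_def field_simps power2_eq_square)
    ultimately show ?thesis using Y1 tr by simp
  qed
  have "C1 + 1 \<le> K * \<delta> - C2"
    using \<delta> by (simp add: K' field_simps)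
  also have "\<dots> \<le> K * Y2 - C2" using Y2 K1 by simp
  also have "\<dots> \<le> Y1 + K * Y2 - H z * (a z \<bullet> p z) / W z" using low by simp
  finally have le: "C1 + 1 \<le> Y1 + K * Y2 - H z * (a z \<bullet> p z) / W z" .
  have "1 * (C1 + 1) \<le> K * (Y1 + K * Y2 - H z * (a z \<bullet> p z) / W z)"
    using le K1 C1 by (intro mult_mono) auto
  then show False using key by simp
qed

text \<open>At the centre \<open>f\<close> is positive, whereas \<open>\<phi> \<le> - 1 / 2\<close>
  on the sphere, so \<open>f\<close> has an interior maximum over the closed ball. There
  \<open>p\<close> is not steep, and comparison with \<open>f z0\<close> carries the bound to the
  centre.\<close>

lemma interior_gradient_bound:
  assumes R: "R > 0" "cball z0 R \<subseteq> S"
    and Mu: "\<And>x. x \<in> cball z0 R \<Longrightarrow> \<bar>u x\<bar> \<le> Mu"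
    and MH: "\<And>x. x \<in> cball z0 R \<Longrightarrow> \<bar>H x\<bar> \<le> MH" "\<And>x. x \<in> cball z0 R \<Longrightarrow> norm (h x) \<le> MH"
    and MX: "\<And>x. x \<in> cball z0 R \<Longrightarrow> norm x \<le> MX"
  shows "norm (g z0) \<le> gradient_bound DIM('a) \<epsilon> R Mu MH MX"
proof -
  define c where "c = barrier_scale Mu"
  define K where "K = barrier_exponent DIM('a) \<epsilon> R Mu MH MX"
  define \<phi> where "\<phi> = (\<lambda>x. (u x - u z0) / barrier_scale Mu + 1 - 2 * ((x - z0) \<bullet> (x - z0)) / R\<^sup>2)"
  define f where "f x = W x * (exp (K * \<phi> x) - 1)" for x
  have z0: "z0 \<in> cball z0 R" using R by simp
  have Mu0: "Mu \<ge> 0" using Mu[OF z0] by linarith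
  have MH0: "MH \<ge> 0" using MH(1)[OF z0] by linarith
  have MX0: "MX \<ge> 0" using MX[OF z0] norm_ge_zero[of z0] by linarith
  have c: "c > 0" using Mu0 by (simp add: c_def barrier_scale_def)
  have K: "K > 0" unfolding K_def barrier_exponent_def c_def[symmetric]
    using MH0 MX0 \<epsilon> R c by (intro add_nonneg_pos divide_nonneg_pos add_nonneg_nonneg) auto
  have cu: "continuous_on S u" using u has_derivative_continuous continuous_at_imp_continuous_on by blast
  have cW: "continuous_on S W"
    using W_has_derivative has_derivative_continuous continuous_at_imp_continuous_on by blast
  have c\<phi>: "continuous_on S \<phi>"
    unfolding \<phi>_def using cu c R by (auto intro!: continuous_intros simp: c_def)
  have cf: "continuous_on S f"
    unfolding f_def using cW c\<phi> by (auto intro!: continuous_intros)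
  obtain z where z: "z \<in> cball z0 R" and fmax: "\<And>x. x \<in> cball z0 R \<Longrightarrow> f x \<le> f z"
    using continuous_attains_sup[of "cball z0 R" f] continuous_on_subset[OF cf R(2)] z0
    by (metis compact_cball empty_iff)
  have zS: "z \<in> S" using z R by blast
  have du: "(u x - u z0) / c \<le> 1 / 2" if "x \<in> cball z0 R" for x
  proof -
    have "u x - u z0 \<le> 2 * Mu" using Mu[OF that] Mu[OF z0] by linarith
    also have "\<dots> \<le> 1 / 2 * c" by (simp add: c_def barrier_scale_def)
    finally show ?thesis using c by (simp add: divide_le_eq)
  qed
  have f0: "f z0 = W z0 * (exp K - 1)" by (simp add: f_def \<phi>_def)
  have "f z > 0" using fmax[OF z0] f0 K W_bounds(1)[of z0] by (smt (verit) mult_pos_pos one_less_exp_iff)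
  then have pos: "\<phi> z > 0"
    using K W_bounds(1)[of z] by (simp add: f_def zero_less_mult_iff)
  have inball: "z \<in> ball z0 R"
  proof (rule ccontr)
    assume "z \<notin> ball z0 R"
    then have "norm (z - z0) = R" using z by (simp add: dist_norm norm_minus_commute)
    then have "(z - z0) \<bullet> (z - z0) = R\<^sup>2" by (simp add: power2_norm_eq_inner[symmetric])
    then have "2 * ((z - z0) \<bullet> (z - z0)) / R\<^sup>2 = 2" using R by simp
    then have "\<phi> z \<le> 1 / 2 + 1 - 2" unfolding \<phi>_def using du[OF z, unfolded c_def] by linarith
    then show False using pos by simp
  qed
  \<comment> \<open>On a neighbourhood where \<open>\<phi>\<close> stays positive \<open>f\<close>
    is nonnegative, so the maximality of \<open>f z\<close> survives squaring.\<close>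
  have "open (ball z0 R \<inter> \<phi> -` {0<..})"
    using R by (intro continuous_open_preimage continuous_on_subset[OF c\<phi>]) auto
  moreover have "z \<in> ball z0 R \<inter> \<phi> -` {0<..}" using inball pos by simp
  ultimately obtain r where r: "r > 0" "ball z r \<subseteq> ball z0 R \<inter> \<phi> -` {0<..}"
    using openE by blast
  have max: "(W x)\<^sup>2 * (exp (K * \<phi> x) - 1)\<^sup>2 \<le> (W z)\<^sup>2 * (exp (K * \<phi> z) - 1)\<^sup>2" if "x \<in> ball z r" for x
  proof -
    have "x \<in> ball z0 R" "\<phi> x > 0" using that r(2) by auto
    then have "f x \<le> f z" "f x \<ge> 0"
      using fmax[of x] W_bounds(1)[of x] K by (auto simp: f_def less_imp_le)
    then have "(f x)\<^sup>2 \<le> (f z)\<^sup>2" by (rule power_mono)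
    then show ?thesis by (simp add: f_def power_mult_distrib)
  qed
  have "norm (p z) < steep_threshold \<epsilon> R Mu MX"
  proof (rule interior_max_not_steep[OF zS r(1) _ R(1) Mu0 _ MX[OF z] MH(1)[OF z] MH(2)[OF z] \<phi>_def K_def pos max])
    show "ball z r \<subseteq> S" using r(2) R(2) by force
    show "norm (z - z0) \<le> R" using z by (simp add: dist_norm norm_minus_commute)
  qed
  then have Wz: "W z \<le> \<epsilon> + steep_threshold \<epsilon> R Mu MX" using W_bounds(4)[of z] by linarith
  have "\<phi> z \<le> 3 / 2"
  proof -
    have "0 \<le> 2 * ((z - z0) \<bullet> (z - z0)) / R\<^sup>2" by simp
    then show ?thesis unfolding \<phi>_def using du[OF z, unfolded c_def] by linarith
  qed
  then have "exp (K * \<phi> z) - 1 \<le> exp (K * (3 / 2)) - 1" using K by simp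
  then have "f z \<le> (\<epsilon> + steep_threshold \<epsilon> R Mu MX) * (exp (K * (3 / 2)) - 1)"
    unfolding f_def using Wz W_bounds(1)[of z] K pos by (intro mult_mono) (auto simp: less_imp_le)
  then have "W z0 * (exp K - 1) \<le> (\<epsilon> + steep_threshold \<epsilon> R Mu MX) * (exp (K * (3 / 2)) - 1)"
    using fmax[OF z0] f0 by simp
  then have "W z0 \<le> (\<epsilon> + steep_threshold \<epsilon> R Mu MX) * (exp (K * (3 / 2)) - 1) / (exp K - 1)"
    using K by (simp add: le_divide_eq)
  moreover have "norm (g z0) \<le> W z0 + MX"
    using norm_triangle_ineq4[of "p z0" "J z0"] W_bounds(3)[of z0] MX[OF z0] by (simp add: p_def J(3))
  ultimately show ?thesis by (simp add: gradient_bound_def K_def)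
qed

end

section \<open>Domains and classical solutions\<close>

lemma has_derivative_grad:
  assumes "f differentiable (at z)"
  shows "(f has_derivative (\<lambda>v. grad f z \<bullet> v)) (at z)"
proof -
  define D where "D = frechet_derivative f (at z)"
  have f: "(f has_derivative D) (at z)"
    using assms by (simp add: D_def frechet_derivative_works)
  then have lin: "linear D" by (rule has_derivative_linear)
  have "D v = grad f z \<bullet> v" for v
  proof -
    have "D v = D (\<Sum>b\<in>Basis. (v \<bullet> b) *\<^sub>R b)" by (simp add: euclidean_representation)
    also have "\<dots> = (\<Sum>b\<in>Basis. (v \<bullet> b) * D b)" by (simp add: linear_sum[OF lin] linear_scale[OF lin])
    also have "\<dots> = grad f z \<bullet> v"
      by (simp add: grad_def D_def inner_sum_left inner_commute[of v] mult.commute)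
    finally show ?thesis .
  qed
  then have "D = (\<lambda>v. grad f z \<bullet> v)" by blast
  with f show ?thesis by blast
qed

lemma Ck_differentiable_at:
  "Ck (Suc k) S f \<Longrightarrow> open S \<Longrightarrow> z \<in> S \<Longrightarrow> f differentiable (at z)"
  by (auto simp: differentiable_on_eq_differentiable_at)

lemma Ck_continuous_on: "Ck (Suc k) S f \<Longrightarrow> continuous_on S f"
  by (simp add: differentiable_imp_continuous_on)

lemma Ck_Suc_partial:
  "Ck (Suc k) S f \<Longrightarrow> b \<in> Basis \<Longrightarrow> Ck k S (\<lambda>z. frechet_derivative f (at z) b)"
  by simp

lemma Ck2_grad_has_derivative:
  assumes f: "Ck (Suc (Suc k)) S f" and z: "open S" "z \<in> S"
  shows "(grad f has_derivative
    (\<lambda>v. \<Sum>b\<in>Basis. (grad (\<lambda>x. frechet_derivative f (at x) b) z \<bullet> v) *\<^sub>R b)) (at z)"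
  unfolding grad_def[of f, abs_def]
  by (intro has_derivative_sum has_derivative_scaleR_left has_derivative_grad
      Ck_differentiable_at[OF Ck_Suc_partial[OF f] z])

text \<open>The abstract derivative of \<open>grad f\<close> is identified with the sum over second
  partials on the open set \<open>S\<close>, and differentiability is transferred from that
  sum.\<close>

lemma Ck3_hessian_differentiable:
  assumes f: "Ck (Suc (Suc (Suc k))) S f" and z: "open S" "z \<in> S"
  shows "(\<lambda>x. frechet_derivative (grad f) (at x) v) differentiable (at z)"
proof -
  let ?hess = "\<lambda>x. \<Sum>b\<in>Basis. (grad (\<lambda>x. frechet_derivative f (at x) b) x \<bullet> v) *\<^sub>R b"
  have "((\<lambda>x. grad (\<lambda>y. frechet_derivative f (at y) b) x \<bullet> v) has_derivative
     (\<lambda>k. (\<Sum>b'\<in>Basis. (grad (\<lambda>x. frechet_derivative (\<lambda>y. frechet_derivative f (at y) b) (at x) b') z \<bullet> k) *\<^sub>R b') \<bullet> v)) (at z)"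
    if "b \<in> Basis" for b
    by (intro has_derivative_inner_left Ck2_grad_has_derivative[OF Ck_Suc_partial[OF f that] z])
  then have "(\<lambda>x. grad (\<lambda>y. frechet_derivative f (at y) b) x \<bullet> v) differentiable (at z)" if "b \<in> Basis" for b
    using that differentiableI by blast
  then have "?hess differentiable (at z)"
    by (intro differentiable_sum differentiable_scaleR differentiable_const) auto
  moreover have "?hess x = frechet_derivative (grad f) (at x) v" if "x \<in> S" for x
    by (simp flip: frechet_derivative_at[OF Ck2_grad_has_derivative[OF f z(1) that]])
  ultimately show ?thesis
    unfolding differentiable_def by (blast intro: has_derivative_transform_within_open[OF _ z])
qed

lemma continuous_on_grad:
  assumes "Ck 1 S f"
  shows "continuous_on S (grad f)"
  using assms unfolding grad_def[abs_def]
  by (intro continuous_on_sum continuous_on_scaleR continuous_on_const) auto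

text \<open>Differentiating \<open>1 / W\<close> contributes
  \<open>- (p \<bullet> P b) / W ^ 3\<close>; weighted with \<open>p \<bullet> b\<close> and summed
  over the basis this becomes \<open>- (p \<bullet> P p) / W ^ 3\<close>.\<close>

lemma divergence_normalized_field:
  fixes p :: "'a::euclidean_space \<Rightarrow> 'a"
  assumes \<epsilon>: "\<epsilon> \<noteq> 0" and p: "(p has_derivative P) (at z)"
  defines "W \<equiv> area_density \<epsilon> (p z)"
  shows "divergence (\<lambda>x. (1 / area_density \<epsilon> (p x)) *\<^sub>R p x) z
    = ((\<Sum>b\<in>Basis. P b \<bullet> b) - (P (p z) \<bullet> p z) / W\<^sup>2) / W"
proof -
  have "\<epsilon>\<^sup>2 + (norm (p z))\<^sup>2 > 0" using \<epsilon> by (simp add: add_pos_nonneg)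
  then have W: "W > 0" by (simp add: W_def area_density_def)
  have lin: "linear P" using p by (rule has_derivative_linear)
  have "((\<lambda>x. inverse (area_density \<epsilon> (p x)) *\<^sub>R p x) has_derivative
      (\<lambda>v. inverse W *\<^sub>R P v + (- (inverse W * ((p z \<bullet> P v) / W) * inverse W)) *\<^sub>R p z)) (at z)"
    using has_derivative_scaleR[OF Deriv.has_derivative_inverse[OF _ has_derivative_area_density[OF \<epsilon> p]] p]
      W unfolding W_def by (metis less_irrefl)
  then have "frechet_derivative (\<lambda>x. (1 / area_density \<epsilon> (p x)) *\<^sub>R p x) (at z) =
      (\<lambda>v. inverse W *\<^sub>R P v + (- (inverse W * ((p z \<bullet> P v) / W) * inverse W)) *\<^sub>R p z)"
    unfolding inverse_eq_divide by (rule frechet_derivative_at[symmetric])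
  then have "divergence (\<lambda>x. (1 / area_density \<epsilon> (p x)) *\<^sub>R p x) z
     = (\<Sum>b\<in>Basis. inverse W * (P b \<bullet> b) - inverse W ^ 3 * ((p z \<bullet> b) * (p z \<bullet> P b)))"
    by (simp add: divergence_def inner_add_left inner_diff_left divide_inverse power_numeral_reduce mult_ac)
  also have "\<dots> = inverse W * (\<Sum>b\<in>Basis. P b \<bullet> b) - inverse W ^ 3 * (\<Sum>b\<in>Basis. (p z \<bullet> b) * (p z \<bullet> P b))"
    by (simp add: sum_subtractf sum_distrib_left)
  also have "(\<Sum>b\<in>Basis. (p z \<bullet> b) * (p z \<bullet> P b)) = p z \<bullet> P (\<Sum>b\<in>Basis. (p z \<bullet> b) *\<^sub>R b)"
    by (simp add: linear_sum[OF lin] linear_scale[OF lin] inner_sum_right)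
  finally have "divergence (\<lambda>x. (1 / area_density \<epsilon> (p x)) *\<^sub>R p x) z
     = inverse W * (\<Sum>b\<in>Basis. P b \<bullet> b) - inverse W ^ 3 * (P (p z) \<bullet> p z)"
    by (simp only: euclidean_representation inner_commute[of "p z" "P (p z)"])
  then show ?thesis
    using W by (simp add: field_simps power_numeral_reduce)
qed

text \<open>The equation contains only \<open>\<epsilon>\<^sup>2\<close>, so
  \<open>\<bar>\<epsilon>\<bar>\<close> supplies the positive parameter. Since
  \<open>J x \<bullet> x = 0\<close>, the derivative of \<open>J\<close> drops out of the trace and
  of the quadratic form.\<close>

lemma twisted_solutionI:
  fixes J :: "'a::euclidean_space \<Rightarrow> 'a"
  assumes S: "open S" and \<epsilon>: "\<epsilon> \<noteq> 0"
    and J: "linear J" "\<And>x y. J x \<bullet> y = - (x \<bullet> J y)" "\<And>x. norm (J x) = norm x"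
    and u: "Ck 3 S u" and H: "Ck 1 S H"
    and eqn: "\<forall>z\<in>S. divergence (\<lambda>w. (1 / sqrt (\<epsilon>\<^sup>2 + (norm (grad u w + J w))\<^sup>2)) *\<^sub>R (grad u w + J w)) z = H z"
  shows "twisted_solution S u H (grad u) (grad H) (\<lambda>z. frechet_derivative (grad u) (at z))
    (\<lambda>z v. frechet_derivative (\<lambda>x. frechet_derivative (grad u) (at x) v) (at z)) J \<bar>\<epsilon>\<bar>"
proof (rule twisted_solution.intro)
  show "open S" by fact
  show "linear J" by fact
  show "J x \<bullet> y = - (x \<bullet> J y)" for x y by fact
  show "norm (J x) = norm x" for x by fact
  show "0 < \<bar>\<epsilon>\<bar>" using \<epsilon> by simp
  have u3: "Ck (Suc (Suc (Suc 0))) S u" using u by (simp only: numeral_3_eq_3)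
  fix z assume z: "z \<in> S"
  show "(u has_derivative (\<lambda>v. grad u z \<bullet> v)) (at z)"
    by (intro has_derivative_grad Ck_differentiable_at[OF u3 S z])
  show g: "(grad u has_derivative frechet_derivative (grad u) (at z)) (at z)"
    using Ck2_grad_has_derivative[OF u3 S z] differentiableI frechet_derivative_works by blast
  show "((\<lambda>x. frechet_derivative (grad u) (at x) v) has_derivative
      frechet_derivative (\<lambda>x. frechet_derivative (grad u) (at x) v) (at z)) (at z)" for v
    using Ck3_hessian_differentiable[OF u3 S z] by (simp add: frechet_derivative_works)
  show "(H has_derivative (\<lambda>v. grad H z \<bullet> v)) (at z)"
    by (intro has_derivative_grad Ck_differentiable_at[OF H[unfolded One_nat_def] S z])
  define p where "p x = grad u x + J x" for x
  define P where "P v = frechet_derivative (grad u) (at z) v + J v" for v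
  define W where "W = area_density \<epsilon> (p z)"
  have "\<epsilon>\<^sup>2 + (norm (p z))\<^sup>2 > 0" using \<epsilon> by (simp add: add_pos_nonneg)
  then have W: "W > 0" by (simp add: W_def area_density_def)
  have "(p has_derivative P) (at z)"
    unfolding p_def P_def
    by (intro has_derivative_add g bounded_linear_imp_has_derivative)
       (use J(1) linear_conv_bounded_linear in auto)
  from divergence_normalized_field[OF \<epsilon> this] eqn z
  have "H z = ((\<Sum>b\<in>Basis. P b \<bullet> b) - (P (p z) \<bullet> p z) / W\<^sup>2) / W"
    by (simp add: p_def W_def area_density_def)
  moreover have "J x \<bullet> x = 0" for x using J(2)[of x x] by (simp add: inner_commute)
  ultimately have "(\<Sum>b\<in>Basis. frechet_derivative (grad u) (at z) b \<bullet> b)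
      - (frechet_derivative (grad u) (at z) (p z) \<bullet> p z) / W\<^sup>2 = H z * W"
    using W by (simp add: P_def inner_add_left)
  then show "(\<Sum>b\<in>Basis. frechet_derivative (grad u) (at z) b \<bullet> b)
      - (frechet_derivative (grad u) (at z) (grad u z + J z) \<bullet> (grad u z + J z))
        / (area_density \<bar>\<epsilon>\<bar> (grad u z + J z))\<^sup>2 = H z * area_density \<bar>\<epsilon>\<bar> (grad u z + J z)"
    by (simp add: W_def p_def area_density_def)
qed

section \<open>Sup norms and distances for compactly contained sets\<close>

lemma norm_le_supnorm:
  assumes "compactly_contained A B" "continuous_on B f" "z \<in> A"
  shows "norm (f z) \<le> supnorm A f"
proof -
  \<comment> \<open>A real supremum dominates the members of a set that is bounded above;
    compactness of the closure ensures this.\<close>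
  have "compact ((\<lambda>z. norm (f z)) ` closure A)"
    using assms unfolding compactly_contained_def
    by (intro compact_continuous_image continuous_on_norm) (auto intro: continuous_on_subset)
  then have "bdd_above ((\<lambda>z. norm (f z)) ` A)"
    using closure_subset by (meson bdd_above_mono bounded_imp_bdd_above compact_imp_bounded image_mono)
  then show ?thesis unfolding supnorm_def using assms(3) by (rule cSUP_upper[rotated])
qed

text \<open>A segment from \<open>z\<close> to a point outside \<open>B\<close> meets the frontier
  of \<open>B\<close> at some \<open>w\<close>, and its part up to \<open>w\<close> already meets
  the frontier of \<open>A\<close>. The distance of these two points is at most the length of the
  segment.\<close>

lemma compactly_contained_frontier_dist:
  fixes A B :: "'a::euclidean_space set"
  assumes A: "open A" "A \<noteq> {}" and B: "open B" "bounded B" and AB: "compactly_contained A B"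
  shows "setdist (frontier A) (frontier B) > 0"
    and "z \<in> A \<Longrightarrow> ball z (setdist (frontier A) (frontier B)) \<subseteq> B"
proof -
  have cl: "closure A \<subseteq> B" "compact (closure A)" using AB by (auto simp: compactly_contained_def)
  have bA: "bounded A" using cl by (meson bounded_subset closure_subset compact_imp_bounded)
  have sub: "A \<subseteq> B" using cl closure_subset by blast
  have ne: "A \<noteq> UNIV" "B \<noteq> UNIV" using bA B not_bounded_UNIV by auto
  \<comment> \<open>\<open>setdist\<close> has the value 0 when a set is empty, so both frontiers
    are first shown to be nonempty.\<close>
  have "frontier A \<noteq> {}" "frontier B \<noteq> {}"
    using A ne sub frontier_not_empty by blast+
  moreover have "frontier A \<inter> frontier B = {}"
    using cl frontier_disjoint_eq[of B] B(1) by (auto simp: frontier_def interior_open)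
  moreover have "compact (frontier A)" using bA by (rule compact_frontier_bounded)
  ultimately show "setdist (frontier A) (frontier B) > 0"
    using setdist_eq_0_compact_closed[of "frontier A" "frontier B"] setdist_pos_le[of "frontier A" "frontier B"]
    by (simp add: less_le)
  show "ball z (setdist (frontier A) (frontier B)) \<subseteq> B" if "z \<in> A"
  proof (rule subsetI, rule ccontr)
    fix y assume y: "y \<in> ball z (setdist (frontier A) (frontier B))" "y \<notin> B"
    have "closed_segment z y \<inter> frontier B \<noteq> {}"
      using that sub y by (intro connected_Int_frontier) auto
    then obtain w where w: "w \<in> closed_segment z y" "w \<in> frontier B" by blast
    then have "w \<notin> A" using sub B(1) by (auto simp: frontier_def interior_open)
    then have "closed_segment z w \<inter> frontier A \<noteq> {}"
      using that by (intro connected_Int_frontier) auto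
    then obtain q where q: "q \<in> closed_segment z w" "q \<in> frontier A" by blast
    have "setdist (frontier A) (frontier B) \<le> dist q w"
      using q w by (intro setdist_le_dist)
    also have "\<dots> \<le> dist z w" using dist_in_closed_segment[OF q(1)] by (simp add: dist_commute)
    also have "\<dots> \<le> dist z y" using dist_in_closed_segment[OF w(1)] by (simp add: dist_commute)
    finally show False using y by simp
  qed
qed

section \<open>The rotation field and the uniform constant\<close>

lemma Xf_skew_isometry:
  "linear Xf" "Xf x \<bullet> y = - (x \<bullet> Xf y)" "norm (Xf x) = norm x"
proof -
  show "linear Xf" by (rule linearI) (auto simp: Xf_def)
  show "Xf x \<bullet> y = - (x \<bullet> Xf y)"
    by (simp add: Xf_def inner_prod_def)
  show "norm (Xf x) = norm x"
    by (simp add: Xf_def norm_prod_def add.commute)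
qed

theorem theorem1p2:
  fixes \<epsilon> d Mu MH MX :: real
  assumes "\<epsilon> \<noteq> 0"
  shows "\<exists>C>0. \<forall>(\<Omega>::((real^'n) \<times> (real^'n)) set) (H::(real^'n) \<times> (real^'n) \<Rightarrow> real)
            (u::(real^'n) \<times> (real^'n) \<Rightarrow> real) \<Omega>t \<Omega>h.
     is_domain \<Omega> \<and> bounded \<Omega> \<and> Ck 1 \<Omega> H \<and> Ck 3 \<Omega> u \<and>
     (\<forall>z\<in>\<Omega>. divergence (\<lambda>w. (1 / sqrt (\<epsilon>\<^sup>2 + (norm (grad u w + Xf w))\<^sup>2)) *\<^sub>R
                                 (grad u w + Xf w)) z = H z) \<and>
     is_domain \<Omega>t \<and> compactly_contained \<Omega>t \<Omega> \<and>
     is_domain \<Omega>h \<and> compactly_contained \<Omega>h \<Omega>t \<and>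
     setdist (frontier \<Omega>h) (frontier \<Omega>t) = d \<and>
     supnorm \<Omega>t u = Mu \<and> C1norm \<Omega>t H = MH \<and> supnorm \<Omega>t Xf = MX
     \<longrightarrow> (\<forall>z\<in>\<Omega>h. norm (grad u z) \<le> C)"
proof -
  define C where "C = gradient_bound DIM((real^'n) \<times> (real^'n)) \<bar>\<epsilon>\<bar> (d / 2) Mu MH MX"
  have "norm (grad u z) \<le> C"
    if dom: "is_domain \<Omega>" "is_domain \<Omega>t" "is_domain \<Omega>h"
      and CH: "Ck 1 \<Omega> H" and Cu: "Ck 3 \<Omega> u"
      and eqn: "\<forall>z\<in>\<Omega>. divergence (\<lambda>w. (1 / sqrt (\<epsilon>\<^sup>2 + (norm (grad u w + Xf w))\<^sup>2)) *\<^sub>R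
                                 (grad u w + Xf w)) z = H z"
      and cc: "compactly_contained \<Omega>t \<Omega>" "compactly_contained \<Omega>h \<Omega>t"
      and d: "setdist (frontier \<Omega>h) (frontier \<Omega>t) = d"
      and M: "supnorm \<Omega>t u = Mu" "C1norm \<Omega>t H = MH" "supnorm \<Omega>t Xf = MX"
      and z: "z \<in> \<Omega>h"
    for \<Omega> \<Omega>t \<Omega>h :: "((real^'n) \<times> (real^'n)) set" and H u :: "(real^'n) \<times> (real^'n) \<Rightarrow> real" and z
  proof -
    interpret twisted_solution \<Omega> u H "grad u" "grad H" "\<lambda>z. frechet_derivative (grad u) (at z)"
      "\<lambda>z v. frechet_derivative (\<lambda>x. frechet_derivative (grad u) (at x) v) (at z)" Xf "\<bar>\<epsilon>\<bar>"
      using dom(1) unfolding is_domain_def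
      by (intro twisted_solutionI Xf_skew_isometry assms Cu CH eqn) auto
    have sub: "\<Omega>t \<subseteq> \<Omega>" using cc(1) closure_subset by (auto simp: compactly_contained_def)
    have bd: "bounded \<Omega>t"
      using cc(1) unfolding compactly_contained_def by (meson bounded_subset closure_subset compact_imp_bounded)
    have d0: "d > 0" and ball: "ball z d \<subseteq> \<Omega>t"
      using compactly_contained_frontier_dist[OF _ _ _ bd cc(2)] dom z d by (auto simp: is_domain_def)
    have cb: "cball z (d / 2) \<subseteq> \<Omega>t" using ball d0 by (force simp: subset_iff)
    have cont: "continuous_on \<Omega> u" "continuous_on \<Omega> H" "continuous_on \<Omega> (grad H)" "continuous_on \<Omega> Xf"
    proof -
      show "continuous_on \<Omega> u" "continuous_on \<Omega> H"
        using Ck_continuous_on Cu CH unfolding numeral_3_eq_3 One_nat_def by blast+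
      show "continuous_on \<Omega> (grad H)" using CH by (rule continuous_on_grad)
      show "continuous_on \<Omega> Xf"
        using Xf_skew_isometry(1) linear_continuous_on linear_conv_bounded_linear by blast
    qed
    note le = norm_le_supnorm[OF cc(1)]
    have "norm (grad u z) \<le> gradient_bound DIM((real^'n) \<times> (real^'n)) \<bar>\<epsilon>\<bar> (d / 2) Mu MH MX"
    proof (rule interior_gradient_bound)
      show "d / 2 > 0" using d0 by simp
      show "cball z (d / 2) \<subseteq> \<Omega>" using cb sub by blast
      fix x assume "x \<in> cball z (d / 2)"
      then have x: "x \<in> \<Omega>t" using cb by blast
      show "\<bar>u x\<bar> \<le> Mu" using le[OF cont(1) x] M by simp
      have HH: "\<bar>H x\<bar> \<le> supnorm \<Omega>t H" "norm (grad H x) \<le> supnorm \<Omega>t (grad H)"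
        using le[OF cont(2) x] le[OF cont(3) x] by auto
      \<comment> \<open>Both summands of \<open>C1norm\<close> dominate a norm and are thus
        nonnegative, so their sum bounds each.\<close>
      then show "\<bar>H x\<bar> \<le> MH" "norm (grad H x) \<le> MH"
        using M(2) norm_ge_zero[of "grad H x"] unfolding C1norm_def by linarith+
      show "norm x \<le> MX" using le[OF cont(4) x] M by (simp add: Xf_skew_isometry)
    qed
    then show ?thesis by (simp add: C_def)
  qed
  then show ?thesis
    \<comment> \<open>The maximum with 1 secures positivity for all parameter values, including
      those that no solution attains.\<close>
    by (intro exI[of _ "max 1 C"]) (auto intro: max.coboundedI2)
qed

end
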